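(* Let $d=1$, $\gamma\in\mathbb{R}\setminus\{0\}$ and $b\in\mathbb{R}$ with $\gamma+b>0$, and let $Y$ be the relative system of the interacting branching diffusion $Z$ on $\mathbb{R}$ with drift parameter $b$ and interaction parameter $\gamma$. Let $B\subset\mathbb{R}$ be a Borel set. Then, almost surely, $$\lim_{m\to\infty}\left(2^{-m}\sum_{i=1}^{2^m}1_B(Y_m^i)-P(Y_m^i\in B)\right)=0,$$ where $m$ runs through the positive integers and $P(Y_m^i\in B)$ does not depend on $i\in\{1,\dots,2^m\}$.
   Context: Model (with $d=1$ here). Fix $d\ge1$, $b\in\mathbb{R}$ and $\gamma\neq 0$. The process $Z$ starts at time $0$ with one particle at the origin of $\mathbb{R}^d$. For each $m=0,1,2,\dots$, during the time interval $[m,m+1)$ there are exactly $2^m$ particles, with positions $Z_t^i$, $1\le i\le 2^m$; at each integer time $m\ge 1$ every particle is replaced by exactly two offspring, located at the parent's position (labels are arbitrary but independent of the spatial motion). On $[m,m+1)$ the positions satisfy $$\mathrm{d}Z_t^i = \mathrm{d}W_t^{i,m} - bZ_t^i\,\mathrm{d}t + \frac{1}{2^m}\sum_{j=1}^{2^m}\gamma\,(Z_t^j-Z_t^i)\,\mathrm{d}t,\qquad 1\le i\le 2^m,$$ where $\{W^{i,m}\}_{1\le i\le 2^m}$ are independent standard $d$-dimensional Brownian motions on $[m,m+1)$, also independent of the past up to time $m$. Center of mass: for $t\in[m,m+1)$, $\overline{Z_t}:=2^{-m}\sum_{i=1}^{2^m}Z_t^i$. Relative system: $Y_t^i:=Z_t^i-\overline{Z_t}$,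 $1\le i\le 2^{\lfloor t\rfloor}$. By symmetry, for fixed $t$ all $Y_t^i$ have the same law. *)

theory Defs
  imports "HOL-Probability.Probability"
begin

definition (in prob_space) brownian_motion_on :: "real \<Rightarrow> real \<Rightarrow> (real \<Rightarrow> 'a \<Rightarrow> real) \<Rightarrow> bool" where
  "brownian_motion_on u v X \<longleftrightarrow>
     (\<forall>t\<in>{u..<v}. random_variable borel (X t)) \<and>
     (AE \<omega> in M. X u \<omega> = 0) \<and>
     (\<forall>s t. u \<le> s \<longrightarrow> s < t \<longrightarrow> t < v \<longrightarrow>
        distributed M lborel (\<lambda>\<omega>. X t \<omega> - X s \<omega>) (normal_density 0 (sqrt (t - s)))) \<and>
     (\<forall>n (\<tau> :: nat \<Rightarrow> real). \<tau> ` {..n} \<subseteq> {u..<v} \<longrightarrow> strict_mono_on {..n} \<tau> \<longrightarrow>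
        indep_vars (\<lambda>_. borel) (\<lambda>k \<omega>. X (\<tau> (Suc k)) \<omega> - X (\<tau> k) \<omega>) {..<n}) \<and>
     (AE \<omega> in M. continuous_on {u..<v} (\<lambda>t. X t \<omega>))"

text \<open>
  \<open>Z t i\<close> is the position at time \<open>t\<close> of the particle with label \<open>i\<close>; it is meaningful for
  \<open>t \<ge> 0\<close> and \<open>i \<in> {1..2 ^ nat \<lfloor>t\<rfloor>}\<close>, and unconstrained otherwise.  \<open>W m i\<close> drives particle
  \<open>i\<close> on the interval \<open>[m, m + 1)\<close>.  At time \<open>m + 1\<close> the parent of particle \<open>j\<close> is the particle
  labelled \<open>par m j \<omega>\<close> on \<open>[m, m + 1)\<close>; the genealogy \<open>par\<close> encodes the arbitrary, possibly
  random labelling of the offspring.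

  As the noise is additive, the SDE is the pathwise integral equation \<open>Z_sde\<close>.

  Since the initial state is deterministic, the past up to time \<open>m\<close> is a function of the genealogy
  and of the \<open>W k i\<close> with \<open>k < m\<close>.  So \<open>W_indep\<close> and \<open>par_indep\<close> together say
  that, for each \<open>m\<close>, the motions \<open>W m i\<close> are independent of each other and of the past up to
  time \<open>m\<close>, and that the labels are independent of the spatial motion.
\<close>

locale interacting_branching_diffusion = prob_space M
  for M :: "'a measure" +
  fixes b \<gamma> :: real
    and W :: "nat \<Rightarrow> nat \<Rightarrow> real \<Rightarrow> 'a \<Rightarrow> real"
    and par :: "nat \<Rightarrow> nat \<Rightarrow> 'a \<Rightarrow> nat"
    and Z :: "real \<Rightarrow> nat \<Rightarrow> 'a \<Rightarrow> real"
  assumes W_brownian: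
    "\<And>m i. i \<in> {1..2 ^ m} \<Longrightarrow> brownian_motion_on (real m) (real m + 1) (W m i)"
  and W_indep:
    "indep_vars (\<lambda>(m, i). Pi\<^sub>M {real m..<real m + 1} (\<lambda>_. borel))
       (\<lambda>(m, i) \<omega>. \<lambda>t\<in>{real m..<real m + 1}. W m i t \<omega>)
       (SIGMA m:UNIV. {1..2 ^ m})"
  and par_indep:
    "indep_set
       (sets (vimage_algebra (space M)
          (\<lambda>\<omega>. \<lambda>(m, j)\<in>(SIGMA m:UNIV. {1..2 ^ Suc m}). par m j \<omega>)
          (Pi\<^sub>M (SIGMA m:UNIV. {1..2 ^ Suc m}) (\<lambda>_. count_space UNIV))))
       (sets (vimage_algebra (space M)
          (\<lambda>\<omega>. \<lambda>(m, i, t)\<in>(SIGMA m:UNIV. {1..2 ^ m} \<times> {real m..<real m + 1}). W m i t \<omega>)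
          (Pi\<^sub>M (SIGMA m:UNIV. {1..2 ^ m} \<times> {real m..<real m + 1}) (\<lambda>_. borel))))"
  and par_two_offspring:
    "AE \<omega> in M. \<forall>m. (\<forall>j\<in>{1..2 ^ Suc m}. par m j \<omega> \<in> {1..2 ^ m}) \<and>
       (\<forall>i\<in>{1..2 ^ m}. card {j \<in> {1..2 ^ Suc m}. par m j \<omega> = i} = 2)"
  and Z_measurable:
    "\<And>t i. 0 \<le> t \<Longrightarrow> i \<in> {1..2 ^ nat \<lfloor>t\<rfloor>} \<Longrightarrow> random_variable borel (Z t i)"
  and Z_start:
    "AE \<omega> in M. Z 0 1 \<omega> = 0"
  and Z_continuous:
    "AE \<omega> in M. \<forall>m. \<forall>i\<in>{1..2 ^ m}. continuous_on {real m..<real m + 1} (\<lambda>t. Z t i \<omega>)"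
  and Z_sde:
    "AE \<omega> in M. \<forall>m. \<forall>i\<in>{1..2 ^ m}. \<forall>t\<in>{real m..<real m + 1}.
       Z t i \<omega> = Z (real m) i \<omega> + (W m i t \<omega> - W m i (real m) \<omega>)
         + integral {real m..t} (\<lambda>s. - b * Z s i \<omega>
             + (1 / 2 ^ m) * (\<Sum>j = 1..2 ^ m. \<gamma> * (Z s j \<omega> - Z s i \<omega>)))"
  and Z_branching:
    "AE \<omega> in M. \<forall>m. \<forall>j\<in>{1..2 ^ Suc m}.
       ((\<lambda>t. Z t (par m j \<omega>) \<omega>) \<longlongrightarrow> Z (real (Suc m)) j \<omega>) (at_left (real (Suc m)))"

definition center_of_mass :: "(real \<Rightarrow> nat \<Rightarrow> 'a \<Rightarrow> real) \<Rightarrow> real \<Rightarrow> 'a \<Rightarrow> real" where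
  "center_of_mass Z t \<omega> = (1 / 2 ^ nat \<lfloor>t\<rfloor>) * (\<Sum>i = 1..2 ^ nat \<lfloor>t\<rfloor>. Z t i \<omega>)"

definition relative_system :: "(real \<Rightarrow> nat \<Rightarrow> 'a \<Rightarrow> real) \<Rightarrow> real \<Rightarrow> nat \<Rightarrow> 'a \<Rightarrow> real" where
  "relative_system Z t i \<omega> = Z t i \<omega> - center_of_mass Z t \<omega>"

end

theory Submission
  imports Defs
begin

text \<open>
  Write \<open>c = \<gamma> + b\<close>. Subtracting the mean of the equations from each of them
  cancels the interaction: within one unit of time the relative positions follow \<open>dY\<^sup>i
  = dW\<^sup>i - d(mean of the W\<^sup>j) - c Y\<^sup>i dt\<close>. As branching preserves the
  center of mass, integrating up to the next branching time gives the recursion \<open>Y_{m+1}^j =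
  exp (- c) * Y_m^p + \<xi>_m^p - mean_l \<xi>_m^l\<close>, where \<open>p\<close> is the parent
  of \<open>j\<close> and the \<open>\<xi>_m^l\<close>, stochastic integrals of \<open>exp (- c *
  (m + 1 - s))\<close> against \<open>W\<close>, are independent centred normal variables of one
  common variance \<open>v > 0\<close>. This is \<open>relative_system_eq_rel_pos\<close>.

  Fix the genealogy. Every \<open>Y_m^i\<close> is then a finite linear combination of the
  \<open>\<xi>\<close>, and the recursion passes to covariances: \<open>C_{m+1}(i,j) = exp (- 2 c)
  * C_m(p,q) + v * ([p = q] - 2^-m)\<close> for the parents \<open>p\<close>, \<open>q\<close> of
  \<open>i\<close>, \<open>j\<close>. On the diagonal nothing depends on the particle or on the
  genealogy, so all \<open>Y_m^i\<close> have one normal law, and this survives averaging over the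
  genealogy, which is independent of the motions.

  For the strong law it is enough that the second moments of \<open>D_m = 2^-m * (number of i with
  Y_m^i in B) - P(Y_m^i in B)\<close> are summable, since then the sum of the
  \<open>D_m\<^sup>2\<close> is almost surely finite. The second moment is the average over all
  pairs of the covariances of the indicators, and it is controlled by two facts. For jointly
  normal variables of equal variance and correlation \<open>\<rho>\<close>, the covariance of the
  indicators of any Borel set is at most \<open>4 * \<bar>\<rho>\<bar>\<close>
  (\<open>indicator_cov_linear_combinations_le\<close>). And the average of
  \<open>\<bar>C_m(i,j)\<bar>\<close> over all pairs, in units of \<open>v\<close>, is bounded by
  \<open>Q_m\<close> with \<open>Q_{m+1} = exp (- 2 c) * Q_m + 2 * 2^-m\<close>
  (\<open>mean_abs_rel_cov_le\<close>), because each pair of parents has four pairs of offspring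
  and two random particles have the same parent with probability \<open>2^-m\<close>. As \<open>c
  > 0\<close>, the sequence \<open>Q\<close> is summable, while the variances stay away from zero.
  The bounds are uniform in the genealogy, so splitting the probability space according to the
  finitely many genealogies up to time \<open>m\<close>
  (\<open>expectation_le_if_le_for_each_genealogy\<close>) carries them over to the random one.
\<close>

section \<open>Centred normal random variables\<close>

context prob_space
begin

text \<open>
  The law is given by its characteristic function rather than by a density, so that the degenerate
  law with variance \<open>v = 0\<close> is included. It occurs: the two particles present at time
  1 have relative position 0.
\<close>
definition centred_normal :: "('a \<Rightarrow> real) \<Rightarrow> real \<Rightarrow> bool" where
  "centred_normal X v \<longleftrightarrow> random_variable borel X \<and>
     (\<forall>t. char (distr M borel X) t = complex_of_real (exp (- v * t\<^sup>2 / 2)))"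

lemma centred_normalD:
  assumes "centred_normal X v"
  shows "random_variable borel X"
    and "char (distr M borel X) t = complex_of_real (exp (- v * t\<^sup>2 / 2))"
  using assms by (auto simp: centred_normal_def)

lemma expectation_indicator_vimage:
  assumes [measurable]: "random_variable borel X" "B \<in> sets borel"
  shows "expectation (\<lambda>\<omega>. indicator B (X \<omega>)) = prob {\<omega> \<in> space M. X \<omega> \<in> B}"
proof -
  have "expectation (\<lambda>\<omega>. indicator B (X \<omega>)) = expectation (indicat_real {\<omega> \<in> space M. X \<omega> \<in> B})"
    by (intro Bochner_Integration.integral_cong) (auto simp: indicator_def)
  also have "\<dots> = prob {\<omega> \<in> space M. X \<omega> \<in> B}"
    by (subst Bochner_Integration.integral_indicator) (auto intro!: arg_cong[where f = prob])
  finally show ?thesis .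
qed

lemma char_distr:
  assumes [measurable]: "random_variable borel X"
  shows "char (distr M borel X) t = (CLINT \<omega>|M. iexp (t * X \<omega>))"
  unfolding char_def by (subst integral_distr) auto

lemma centred_normal_scale:
  assumes "centred_normal X v"
  shows "centred_normal (\<lambda>\<omega>. a * X \<omega>) (a\<^sup>2 * v)"
proof -
  note [measurable] = centred_normalD(1)[OF assms]
  have "char (distr M borel (\<lambda>\<omega>. a * X \<omega>)) t = char (distr M borel X) (t * a)" for t
    by (subst (1 2) char_distr) (auto simp: mult.assoc)
  then show ?thesis
    using centred_normalD(2)[OF assms] unfolding centred_normal_def
    by (auto simp: power_mult_distrib mult_ac)
qed

lemma centred_normal_sum:
  assumes "indep_vars (\<lambda>_. borel) X T" and fin: "finite T"
    and X: "\<And>p. p \<in> T \<Longrightarrow> centred_normal (X p) (v p)"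
  shows "centred_normal (\<lambda>\<omega>. \<Sum>p\<in>T. a p * X p \<omega>) (\<Sum>p\<in>T. (a p)\<^sup>2 * v p)"
proof -
  have ind: "indep_vars (\<lambda>_. borel) (\<lambda>p \<omega>. a p * X p \<omega>) T"
    by (rule indep_vars_compose2[OF assms(1)]) auto
  have *: "\<And>p. p \<in> T \<Longrightarrow> centred_normal (\<lambda>\<omega>. a p * X p \<omega>) ((a p)\<^sup>2 * v p)"
    by (intro centred_normal_scale X)
  have "char (distr M borel (\<lambda>\<omega>. \<Sum>p\<in>T. a p * X p \<omega>)) t
      = complex_of_real (exp (- (\<Sum>p\<in>T. (a p)\<^sup>2 * v p) * t\<^sup>2 / 2))" for t
  proof -
    have "char (distr M borel (\<lambda>\<omega>. \<Sum>p\<in>T. a p * X p \<omega>)) t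
        = (\<Prod>p\<in>T. complex_of_real (exp (- ((a p)\<^sup>2 * v p) * t\<^sup>2 / 2)))"
      using centred_normalD(2)[OF *] by (simp add: char_distr_sum[OF ind])
    also have "\<dots> = complex_of_real (exp (\<Sum>p\<in>T. - ((a p)\<^sup>2 * v p) * t\<^sup>2 / 2))"
      using fin by (simp add: exp_sum)
    also have "(\<Sum>p\<in>T. - ((a p)\<^sup>2 * v p) * t\<^sup>2 / 2) = - (\<Sum>p\<in>T. (a p)\<^sup>2 * v p) * t\<^sup>2 / 2"
      by (simp only: sum_distrib_right sum_divide_distrib sum_negf[symmetric])
    finally show ?thesis .
  qed
  moreover have "random_variable borel (\<lambda>\<omega>. \<Sum>p\<in>T. a p * X p \<omega>)"
    by (intro borel_measurable_sum centred_normalD(1)[OF *])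
  ultimately show ?thesis
    by (simp add: centred_normal_def)
qed

lemma centred_normal_law_unique:
  assumes "centred_normal X v" "centred_normal Y v"
  shows "distr M borel X = distr M borel Y"
proof (rule Levy_uniqueness)
  show "real_distribution (distr M borel X)" "real_distribution (distr M borel Y)"
    using assms by (auto simp: centred_normal_def)
  show "char (distr M borel X) = char (distr M borel Y)"
    using assms by (auto simp: centred_normal_def)
qed

lemma centred_normal_if_distributed:
  assumes "distributed M lborel X (normal_density 0 s)" and "s > 0"
  shows "centred_normal X (s\<^sup>2)"
proof -
  have [measurable]: "random_variable borel X"
    using distributed_measurable[OF assms(1)] by simp
  have "distributed M lborel (\<lambda>\<omega>. (X \<omega> - 0) / s) std_normal_density"
    using assms normal_standard_normal_convert[of s X 0] by simp
  then have *: "distr M borel (\<lambda>\<omega>. X \<omega> / s) = std_normal_distribution"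
    by (auto simp: distributed_def cong: distr_cong)
  have "centred_normal (\<lambda>\<omega>. X \<omega> / s) 1"
    unfolding centred_normal_def * by (simp add: char_std_normal_distribution)
  from centred_normal_scale[OF this, of s] show ?thesis
    using assms(2) by simp
qed

lemma centred_normal_distributed:
  assumes "centred_normal X v" and "v > 0"
  shows "distributed M lborel X (normal_density 0 (sqrt v))"
proof -
  note [measurable] = centred_normalD(1)[OF assms(1)]
  define s where "s = sqrt v"
  have s: "s > 0" "s\<^sup>2 = v" using assms(2) by (auto simp: s_def)
  have "(inverse s)\<^sup>2 * v = 1"
    using assms(2) unfolding power_inverse s(2) by simp
  then have "centred_normal (\<lambda>\<omega>. inverse s * X \<omega>) 1"
    using centred_normal_scale[OF assms(1), of "inverse s"] by metis
  moreover have "(\<lambda>\<omega>. inverse s * X \<omega>) = (\<lambda>\<omega>. X \<omega> / s)"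
    by (auto simp: divide_inverse)
  ultimately have "centred_normal (\<lambda>\<omega>. X \<omega> / s) 1" by simp
  then have "char (distr M borel (\<lambda>\<omega>. X \<omega> / s)) = char std_normal_distribution"
    unfolding char_std_normal_distribution centred_normal_def by (simp add: fun_eq_iff)
  then have "distr M borel (\<lambda>\<omega>. X \<omega> / s) = std_normal_distribution"
    by (intro Levy_uniqueness real_dist_normal_dist) auto
  then have "distributed M lborel (\<lambda>\<omega>. (X \<omega> - 0) / s) std_normal_density"
    unfolding distributed_def by (auto cong: distr_cong)
  then show ?thesis
    using normal_standard_normal_convert[of s X 0] s(1) by (simp add: s_def)
qed

text \<open>
  The characteristic functions converge by bounded convergence.
\<close>
lemma centred_normal_limit:
  assumes X: "\<And>n. centred_normal (X n) (v n)" and v: "v \<longlonglongrightarrow> w"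
    and lim: "AE \<omega> in M. (\<lambda>n. X n \<omega>) \<longlonglongrightarrow> Y \<omega>"
    and [measurable]: "random_variable borel Y"
  shows "centred_normal Y w"
proof -
  note [measurable] = centred_normalD(1)[OF X]
  have "char (distr M borel Y) t = complex_of_real (exp (- w * t\<^sup>2 / 2))" for t
  proof (rule LIMSEQ_unique)
    show "(\<lambda>n. char (distr M borel (X n)) t) \<longlonglongrightarrow> complex_of_real (exp (- w * t\<^sup>2 / 2))"
      unfolding centred_normalD(2)[OF X]
      by (rule tendsto_of_real, rule tendsto_exp, rule tendsto_divide[OF tendsto_mult[OF tendsto_minus[OF v] tendsto_const] tendsto_const]) simp
    have "(\<lambda>n. CLINT \<omega>|M. iexp (t * X n \<omega>)) \<longlonglongrightarrow> (CLINT \<omega>|M. iexp (t * Y \<omega>))"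
    proof (rule integral_dominated_convergence[where w = "\<lambda>_. 1"])
      show "AE \<omega> in M. (\<lambda>n. iexp (t * X n \<omega>)) \<longlonglongrightarrow> iexp (t * Y \<omega>)"
        using lim by eventually_elim (intro tendsto_intros)
    qed auto
    then show "(\<lambda>n. char (distr M borel (X n)) t) \<longlonglongrightarrow> char (distr M borel Y) t"
      by (simp add: char_distr)
  qed
  then show ?thesis by (simp add: centred_normal_def)
qed

section \<open>Independence from factorising characteristic functions\<close>

text \<open>
  Unless \<open>h\<close> vanishes almost surely, it can be normalised to a probability density
  with respect to \<open>M\<close>. The hypothesis says that \<open>X\<close> has the same
  characteristic function under the two measures, hence the same law by uniqueness.
\<close>
lemma expectation_mult_if_char_factors:
  fixes X h :: "'a \<Rightarrow> real"
  assumes X[measurable]: "random_variable borel X" and h[measurable]: "random_variable borel h"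
    and bounds: "\<And>\<omega>. 0 \<le> h \<omega>" "\<And>\<omega>. h \<omega> \<le> c"
    and char: "\<And>s. (CLINT \<omega>|M. iexp (s * X \<omega>) * h \<omega>) = (CLINT \<omega>|M. iexp (s * X \<omega>)) * expectation h"
    and A[measurable]: "A \<in> sets borel"
  shows "expectation (\<lambda>\<omega>. indicator A (X \<omega>) * h \<omega>) = prob {\<omega> \<in> space M. X \<omega> \<in> A} * expectation h"
proof -
  have int_h: "integrable M h"
    using bounds by (intro integrable_const_bound[of _ c]) auto
  have int_1: "integrable M (\<lambda>\<omega>. indicator A (X \<omega>) * h \<omega>)"
    by (rule Bochner_Integration.integrable_bound[OF int_h]) (auto simp: indicator_def)
  show ?thesis
  proof (cases "expectation h = 0")
    case True
    then have "AE \<omega> in M. h \<omega> = 0"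
      using integral_nonneg_eq_0_iff_AE[OF int_h] bounds by auto
    then have "AE \<omega> in M. indicator A (X \<omega>) * h \<omega> = 0"
      by eventually_elim simp
    then have "expectation (\<lambda>\<omega>. indicator A (X \<omega>) * h \<omega>) = 0"
      by (subst integral_cong_AE[where g = "\<lambda>_. 0"]) auto
    with True show ?thesis by simp
  next
    case False
    moreover have "expectation h \<ge> 0" using bounds by (intro integral_nonneg_AE) auto
    ultimately have pos: "expectation h > 0" by simp
    define k where "k = (\<lambda>\<omega>. h \<omega> / expectation h)"
    have [measurable]: "k \<in> borel_measurable M" unfolding k_def by measurable
    have k0: "k \<omega> \<ge> 0" for \<omega> using bounds pos by (simp add: k_def)
    have int_k: "integrable M k" unfolding k_def using int_h by simp
    have "expectation k = 1" unfolding k_def using pos by simp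
    then have nn: "(\<integral>\<^sup>+ \<omega>. ennreal (k \<omega>) \<partial>M) = 1"
      using nn_integral_eq_integral[OF int_k] k0 by simp
    interpret D: prob_space "density M k"
      by (rule prob_spaceI) (simp add: emeasure_density nn cong: nn_integral_cong)
    have "distr (density M k) borel X = distr M borel X"
    proof (rule Levy_uniqueness)
      show "real_distribution (distr M borel X)" by simp
      show "real_distribution (distr (density M k) borel X)" by (rule D.real_distribution_distr) simp
      show "char (distr (density M k) borel X) = char (distr M borel X)"
      proof
        fix s
        have "char (distr (density M k) borel X) s = (CLINT \<omega>|density M k. iexp (s * X \<omega>))"
          by (rule D.char_distr) simp
        also have "\<dots> = (CLINT \<omega>|M. k \<omega> *\<^sub>R iexp (s * X \<omega>))"
          by (rule integral_density) (auto simp: k0)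
        also have "\<dots> = (CLINT \<omega>|M. (iexp (s * X \<omega>) * h \<omega>) / expectation h)"
          by (intro Bochner_Integration.integral_cong) (auto simp: k_def scaleR_conv_of_real)
        also have "\<dots> = (CLINT \<omega>|M. iexp (s * X \<omega>))"
          using pos char[of s] by simp
        also have "\<dots> = char (distr M borel X) s"
          by (rule char_distr[symmetric]) simp
        finally show "char (distr (density M k) borel X) s = char (distr M borel X) s" .
      qed
    qed
    then have "measure (distr (density M k) borel X) A = measure (distr M borel X) A" by simp
    then have "D.prob (X -` A \<inter> space M) = prob (X -` A \<inter> space M)"
      by (simp add: measure_distr)
    moreover have "D.prob (X -` A \<inter> space M) = expectation (\<lambda>\<omega>. k \<omega> * indicator A (X \<omega>))"
    proof -
      have "D.prob (X -` A \<inter> space M) = D.expectation (indicator (X -` A \<inter> space M))"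
        by simp
      also have "\<dots> = expectation (\<lambda>\<omega>. k \<omega> *\<^sub>R indicator (X -` A \<inter> space M) \<omega>)"
        by (rule integral_density) (auto simp: k0)
      also have "\<dots> = expectation (\<lambda>\<omega>. k \<omega> * indicator A (X \<omega>))"
        by (intro Bochner_Integration.integral_cong) (auto simp: indicator_def)
      finally show ?thesis .
    qed
    moreover have "expectation (\<lambda>\<omega>. k \<omega> * indicator A (X \<omega>)) = expectation (\<lambda>\<omega>. indicator A (X \<omega>) * h \<omega>) / expectation h"
      by (simp add: k_def mult.commute)
    moreover have "X -` A \<inter> space M = {\<omega> \<in> space M. X \<omega> \<in> A}" by auto
    ultimately show ?thesis using pos by (simp add: field_simps)
  qed
qed

text \<open>
  Uniqueness of characteristic functions on the line, used once in each variable, replaces the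
  two-dimensional uniqueness theorem. Tilting \<open>M\<close> by the nonnegative weights \<open>1
  + cos (t * Y)\<close> and \<open>1 + sin (t * Y)\<close> shows that every event \<open>X \<in>
  A\<close> is uncorrelated with \<open>iexp (t * Y)\<close>; tilting by the indicator of \<open>X
  \<in> A\<close> then shows that this event is independent of \<open>Y\<close>.
\<close>
lemma indep_var_if_char_factors:
  fixes X Y :: "'a \<Rightarrow> real"
  assumes X[measurable]: "random_variable borel X" and Y[measurable]: "random_variable borel Y"
    and char: "\<And>s t. (CLINT \<omega>|M. iexp (s * X \<omega> + t * Y \<omega>))
      = (CLINT \<omega>|M. iexp (s * X \<omega>)) * (CLINT \<omega>|M. iexp (t * Y \<omega>))"
  shows "indep_var borel X borel Y"
proof -
  define \<phi> where "\<phi> t = (CLINT \<omega>|M. iexp (t * Y \<omega>))" for t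
  have iexp_int: "integrable M (\<lambda>\<omega>. iexp (f \<omega>))" if [measurable]: "f \<in> borel_measurable M" for f
    by (rule integrable_const_bound[of _ 1]) auto
  have joint: "(CLINT \<omega>|M. iexp (s * X \<omega>) * iexp (t * Y \<omega>)) = (CLINT \<omega>|M. iexp (s * X \<omega>)) * \<phi> t" for s t
    using char[of s t] by (simp add: \<phi>_def exp_add distrib_left)
  have joint_int: "integrable M (\<lambda>\<omega>. iexp (s * X \<omega>) * iexp (t * Y \<omega>))" for s t
    by (rule integrable_const_bound[of _ 1]) (auto simp: norm_mult)
  have trig_int: "integrable M (\<lambda>\<omega>. cos (t * Y \<omega>))" "integrable M (\<lambda>\<omega>. sin (t * Y \<omega>))" for t
    by (auto intro!: integrable_const_bound[of _ 1])
  have cos_iexp: "complex_of_real (cos u) = (iexp u + iexp (- u)) / 2"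
    and sin_iexp: "complex_of_real (sin u) = (iexp u - iexp (- u)) / (2 * \<i>)" for u
    using cos_exp_eq[of "complex_of_real u"] sin_exp_eq[of "complex_of_real u"]
    by (simp_all add: cos_of_real sin_of_real)
  have cosE: "complex_of_real (expectation (\<lambda>\<omega>. cos (t * Y \<omega>))) = (\<phi> t + \<phi> (- t)) / 2" for t
  proof -
    have "complex_of_real (expectation (\<lambda>\<omega>. cos (t * Y \<omega>))) = (CLINT \<omega>|M. (iexp (t * Y \<omega>) + iexp (- t * Y \<omega>)) / 2)"
      by (simp only: integral_complex_of_real[symmetric] cos_iexp mult_minus_left)
    also have "\<dots> = (\<phi> t + \<phi> (- t)) / 2"
      unfolding \<phi>_def by (subst integral_divide_zero, subst Bochner_Integration.integral_add) (auto intro!: iexp_int simp del: of_real_mult of_real_minus)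
    finally show ?thesis .
  qed
  have sinE: "complex_of_real (expectation (\<lambda>\<omega>. sin (t * Y \<omega>))) = (\<phi> t - \<phi> (- t)) / (2 * \<i>)" for t
  proof -
    have "complex_of_real (expectation (\<lambda>\<omega>. sin (t * Y \<omega>))) = (CLINT \<omega>|M. (iexp (t * Y \<omega>) - iexp (- t * Y \<omega>)) / (2 * \<i>))"
      by (simp only: integral_complex_of_real[symmetric] sin_iexp mult_minus_left)
    also have "\<dots> = (\<phi> t - \<phi> (- t)) / (2 * \<i>)"
      unfolding \<phi>_def by (subst integral_divide_zero, subst Bochner_Integration.integral_diff) (auto intro!: iexp_int simp del: of_real_mult of_real_minus)
    finally show ?thesis .
  qed
  have cosA: "expectation (\<lambda>\<omega>. indicator A (X \<omega>) * (1 + cos (t * Y \<omega>)))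
      = prob {\<omega> \<in> space M. X \<omega> \<in> A} * expectation (\<lambda>\<omega>. 1 + cos (t * Y \<omega>))"
    if [measurable]: "A \<in> sets borel" for A t
  proof (rule expectation_mult_if_char_factors[where c = 2])
    fix s
    have "(CLINT \<omega>|M. iexp (s * X \<omega>) * complex_of_real (1 + cos (t * Y \<omega>)))
       = (CLINT \<omega>|M. iexp (s * X \<omega>) + (iexp (s * X \<omega>) * iexp (t * Y \<omega>) + iexp (s * X \<omega>) * iexp (- t * Y \<omega>)) / 2)"
      by (intro Bochner_Integration.integral_cong) (auto simp: cos_iexp field_simps)
    also have "\<dots> = (CLINT \<omega>|M. iexp (s * X \<omega>)) * (1 + (\<phi> t + \<phi> (- t)) / 2)"
      by (subst Bochner_Integration.integral_add, intro iexp_int, measurable,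
          intro integrable_divide_zero Bochner_Integration.integrable_add joint_int,
          subst integral_divide_zero, subst Bochner_Integration.integral_add, intro joint_int, intro joint_int,
          unfold joint) (simp add: algebra_simps add_divide_distrib)
    also have "1 + (\<phi> t + \<phi> (- t)) / 2 = complex_of_real (expectation (\<lambda>\<omega>. 1 + cos (t * Y \<omega>)))"
      by (simp add: cosE trig_int prob_space)
    finally show "(CLINT \<omega>|M. iexp (s * X \<omega>) * complex_of_real (1 + cos (t * Y \<omega>)))
       = (CLINT \<omega>|M. iexp (s * X \<omega>)) * complex_of_real (expectation (\<lambda>\<omega>. 1 + cos (t * Y \<omega>)))" .
  next
    fix \<omega>
    show "0 \<le> 1 + cos (t * Y \<omega>)" "1 + cos (t * Y \<omega>) \<le> 2"
      using cos_ge_minus_one[of "t * Y \<omega>"] cos_le_one[of "t * Y \<omega>"] by linarith+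
  qed auto
  have sinA: "expectation (\<lambda>\<omega>. indicator A (X \<omega>) * (1 + sin (t * Y \<omega>)))
      = prob {\<omega> \<in> space M. X \<omega> \<in> A} * expectation (\<lambda>\<omega>. 1 + sin (t * Y \<omega>))"
    if [measurable]: "A \<in> sets borel" for A t
  proof (rule expectation_mult_if_char_factors[where c = 2])
    fix s
    have "(CLINT \<omega>|M. iexp (s * X \<omega>) * complex_of_real (1 + sin (t * Y \<omega>)))
       = (CLINT \<omega>|M. iexp (s * X \<omega>) + (iexp (s * X \<omega>) * iexp (t * Y \<omega>) - iexp (s * X \<omega>) * iexp (- t * Y \<omega>)) / (2 * \<i>))"
      by (intro Bochner_Integration.integral_cong) (auto simp: sin_iexp field_simps)
    also have "\<dots> = (CLINT \<omega>|M. iexp (s * X \<omega>)) * (1 + (\<phi> t - \<phi> (- t)) / (2 * \<i>))"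
      by (subst Bochner_Integration.integral_add, intro iexp_int, measurable,
          intro integrable_divide_zero Bochner_Integration.integrable_diff joint_int,
          subst integral_divide_zero, subst Bochner_Integration.integral_diff, intro joint_int, intro joint_int,
          unfold joint) (simp add: algebra_simps diff_divide_distrib)
    also have "1 + (\<phi> t - \<phi> (- t)) / (2 * \<i>) = complex_of_real (expectation (\<lambda>\<omega>. 1 + sin (t * Y \<omega>)))"
      by (simp add: sinE trig_int prob_space)
    finally show "(CLINT \<omega>|M. iexp (s * X \<omega>) * complex_of_real (1 + sin (t * Y \<omega>)))
       = (CLINT \<omega>|M. iexp (s * X \<omega>)) * complex_of_real (expectation (\<lambda>\<omega>. 1 + sin (t * Y \<omega>)))" .
  next
    fix \<omega>
    show "0 \<le> 1 + sin (t * Y \<omega>)" "1 + sin (t * Y \<omega>) \<le> 2"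
      using sin_ge_minus_one[of "t * Y \<omega>"] sin_le_one[of "t * Y \<omega>"] by linarith+
  qed auto
  have indX: "expectation (\<lambda>\<omega>. indicator A (X \<omega>)) = prob {\<omega> \<in> space M. X \<omega> \<in> A}"
    if "A \<in> sets borel" for A
    by (rule expectation_indicator_vimage[OF X that])
  have prod: "prob {\<omega> \<in> space M. X \<omega> \<in> A \<and> Y \<omega> \<in> C}
      = prob {\<omega> \<in> space M. X \<omega> \<in> A} * prob {\<omega> \<in> space M. Y \<omega> \<in> C}"
    if A[measurable]: "A \<in> sets borel" and C[measurable]: "C \<in> sets borel" for A C
  proof -
    have int1: "integrable M (\<lambda>\<omega>. indicator A (X \<omega>) :: real)"
      "integrable M (\<lambda>\<omega>. indicator A (X \<omega>) * cos (t * Y \<omega>))"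
      "integrable M (\<lambda>\<omega>. indicator A (X \<omega>) * sin (t * Y \<omega>))" for t
      by (auto intro!: integrable_const_bound[of _ 1] simp: indicator_def)
    have c: "expectation (\<lambda>\<omega>. indicator A (X \<omega>) * cos (t * Y \<omega>))
      = prob {\<omega> \<in> space M. X \<omega> \<in> A} * expectation (\<lambda>\<omega>. cos (t * Y \<omega>))" for t
      using cosA[OF A, of t] by (simp add: distrib_left int1 trig_int indX prob_space)
    have s: "expectation (\<lambda>\<omega>. indicator A (X \<omega>) * sin (t * Y \<omega>))
      = prob {\<omega> \<in> space M. X \<omega> \<in> A} * expectation (\<lambda>\<omega>. sin (t * Y \<omega>))" for t
      using sinA[OF A, of t] by (simp add: distrib_left int1 trig_int indX prob_space)
    have iexp_eq: "iexp u = complex_of_real (cos u) + \<i> * complex_of_real (sin u)" for u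
      by (simp add: cis_conv_exp[symmetric] complex_eq_iff)
    have "expectation (\<lambda>\<omega>. indicator C (Y \<omega>) * indicator A (X \<omega>))
      = prob {\<omega> \<in> space M. Y \<omega> \<in> C} * expectation (\<lambda>\<omega>. indicator A (X \<omega>))"
    proof (rule expectation_mult_if_char_factors[where c = 1])
      fix t
      have "(CLINT \<omega>|M. iexp (t * Y \<omega>) * complex_of_real (indicator A (X \<omega>)))
          = (CLINT \<omega>|M. complex_of_real (indicator A (X \<omega>) * cos (t * Y \<omega>))
              + \<i> * complex_of_real (indicator A (X \<omega>) * sin (t * Y \<omega>)))"
        unfolding iexp_eq by (intro Bochner_Integration.integral_cong) (auto simp: algebra_simps)
      also have "\<dots> = complex_of_real (expectation (\<lambda>\<omega>. indicator A (X \<omega>) * cos (t * Y \<omega>)))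
              + \<i> * complex_of_real (expectation (\<lambda>\<omega>. indicator A (X \<omega>) * sin (t * Y \<omega>)))"
        using int1(2,3)[of t] by (simp only: Bochner_Integration.integral_add integral_mult_right_zero
            integral_complex_of_real integrable_of_real integrable_mult_right)
      also have "\<dots> = (complex_of_real (expectation (\<lambda>\<omega>. cos (t * Y \<omega>)))
              + \<i> * complex_of_real (expectation (\<lambda>\<omega>. sin (t * Y \<omega>)))) * complex_of_real (expectation (\<lambda>\<omega>. indicator A (X \<omega>)))"
        by (simp add: c s indX algebra_simps)
      also have "complex_of_real (expectation (\<lambda>\<omega>. cos (t * Y \<omega>)))
              + \<i> * complex_of_real (expectation (\<lambda>\<omega>. sin (t * Y \<omega>))) = (CLINT \<omega>|M. iexp (t * Y \<omega>))"
        unfolding cosE sinE \<phi>_def[symmetric] by (simp add: field_simps)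
      finally show "(CLINT \<omega>|M. iexp (t * Y \<omega>) * complex_of_real (indicator A (X \<omega>)))
        = (CLINT \<omega>|M. iexp (t * Y \<omega>)) * complex_of_real (expectation (\<lambda>\<omega>. indicator A (X \<omega>)))" .
    qed (auto simp: indicator_def)
    moreover have "expectation (\<lambda>\<omega>. indicator C (Y \<omega>) * indicator A (X \<omega>))
      = expectation (indicat_real {\<omega> \<in> space M. X \<omega> \<in> A \<and> Y \<omega> \<in> C})"
      by (intro Bochner_Integration.integral_cong) (auto simp: indicator_def)
    moreover have "\<dots> = prob {\<omega> \<in> space M. X \<omega> \<in> A \<and> Y \<omega> \<in> C}"
      by (subst Bochner_Integration.integral_indicator) (auto intro!: arg_cong[where f = prob])
    ultimately show ?thesis by (simp add: indX mult.commute)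
  qed
  have int_stable: "Int_stable {X -` A \<inter> space M |A. A \<in> sets borel}" for X :: "'a \<Rightarrow> real"
  proof (rule Int_stableI)
    fix a b assume "a \<in> {X -` A \<inter> space M |A. A \<in> sets borel}" "b \<in> {X -` A \<inter> space M |A. A \<in> sets borel}"
    then obtain A B where "A \<in> sets borel" "B \<in> sets borel" "a = X -` A \<inter> space M" "b = X -` B \<inter> space M"
      by auto
    then have "a \<inter> b = X -` (A \<inter> B) \<inter> space M \<and> A \<inter> B \<in> sets borel" by auto
    then show "a \<inter> b \<in> {X -` A \<inter> space M |A. A \<in> sets borel}" by blast
  qed
  show ?thesis
    unfolding indep_var_eq
  proof (intro conjI indep_set_sigma_sets int_stable)
    show "indep_set {X -` A \<inter> space M |A. A \<in> sets borel} {Y -` A \<inter> space M |A. A \<in> sets borel}"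
      unfolding indep_sets2_eq
    proof (intro conjI ballI)
      fix a b assume "a \<in> {X -` A \<inter> space M |A. A \<in> sets borel}" "b \<in> {Y -` A \<inter> space M |A. A \<in> sets borel}"
      then obtain A C where "A \<in> sets borel" "C \<in> sets borel" "a = {\<omega> \<in> space M. X \<omega> \<in> A}"
        "b = {\<omega> \<in> space M. Y \<omega> \<in> C}" by auto
      moreover from this have "a \<inter> b = {\<omega> \<in> space M. X \<omega> \<in> A \<and> Y \<omega> \<in> C}" by auto
      ultimately show "prob (a \<inter> b) = prob a * prob b" using prod by simp
    qed auto
  qed auto
qed

end

section \<open>Indicators of correlated normal variables are nearly uncorrelated\<close>

lemma normal_density_antimono_abs:
  assumes "\<bar>x\<bar> \<le> \<bar>y\<bar>"
  shows "normal_density 0 s y \<le> normal_density 0 s x"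
proof -
  have "x\<^sup>2 \<le> y\<^sup>2" using assms by (rule abs_le_square_iff[THEN iffD1])
  then have "- y\<^sup>2 / (2 * s\<^sup>2) \<le> - x\<^sup>2 / (2 * s\<^sup>2)"
    by (intro divide_right_mono) auto
  then show ?thesis
    unfolding normal_density_def by (intro mult_left_mono) auto
qed

lemma normal_density_le_inverse:
  assumes "s > 0"
  shows "normal_density 0 s x \<le> 1 / s"
proof -
  have "normal_density 0 s x \<le> normal_density 0 s 0"
    by (rule normal_density_antimono_abs) simp
  also have "\<dots> = 1 / (sqrt (2 * pi) * s)"
    using assms by (simp add: normal_density_def real_sqrt_mult)
  also have "\<dots> \<le> 1 / s"
  proof (rule divide_left_mono)
    have "1 \<le> sqrt (2 * pi)" using pi_ge_two by simp
    then show "s \<le> sqrt (2 * pi) * s" using assms by simp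
  qed (use assms in auto)
  finally show ?thesis .
qed

text \<open>
  The difference of the shifted and the original density is nonnegative exactly to the right of
  the midpoint \<open>y / 2\<close> and has total integral 0. So among all sets the half-line
  beyond \<open>y / 2\<close> has the largest difference of probabilities, and there it equals the
  probability of an interval of length \<open>y\<close>, on which the density is at most \<open>1
  / s\<close>.
\<close>
lemma normal_shift_diff_le_nonneg:
  assumes s: "s > 0" and y: "0 \<le> y" and B[measurable]: "B \<in> sets borel"
  shows "\<bar>(LBINT r. indicator B (r + y) * normal_density 0 s r) - (LBINT r. indicator B r * normal_density 0 s r)\<bar> \<le> y / s"
proof -
  let ?\<phi> = "normal_density 0 s"
  have \<phi>_int: "integrable lborel ?\<phi>" using s by (rule integrable_normal_density)
  have shift_int: "integrable lborel (\<lambda>r. ?\<phi> (r - y))"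
    using lborel_integrable_real_affine[OF \<phi>_int, of 1 "- y"] by simp
  have ind_int: "integrable lborel (\<lambda>r. indicator C r * f r)"
    if "integrable lborel f" "C \<in> sets borel" for C and f :: "real \<Rightarrow> real"
    using integrable_mult_indicator[of C lborel f] that by simp
  have "(LBINT r. indicator B (r + y) * ?\<phi> r) = (LBINT r. indicator B r * ?\<phi> (r - y))"
    using lborel_integral_real_affine[of 1 "\<lambda>r. indicator B r * ?\<phi> (r - y)" y] by (simp add: add.commute)
  then have D: "(LBINT r. indicator B (r + y) * ?\<phi> r) - (LBINT r. indicator B r * ?\<phi> r)
      = (LBINT r. indicator B r * (?\<phi> (r - y) - ?\<phi> r))" (is "?D = _")
    using ind_int[OF \<phi>_int B] ind_int[OF shift_int B] by (simp add: right_diff_distrib)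
  define g where "g = (\<lambda>r. ?\<phi> (r - y) - ?\<phi> r)"
  have g_int: "integrable lborel g" unfolding g_def using \<phi>_int shift_int by simp
  have g_pos: "g r \<ge> 0" if "r > y / 2" for r
    unfolding g_def using that y by (auto intro!: normal_density_antimono_abs)
  have g_neg: "g r \<le> 0" if "r \<le> y / 2" for r
    unfolding g_def using that y by (auto intro!: normal_density_antimono_abs)
  define K where "K = (LBINT r. indicator {y / 2<..} r * g r)"
  have upper: "(LBINT r. indicator C r * g r) \<le> K" if [measurable]: "C \<in> sets borel" for C
    unfolding K_def using g_pos g_neg
    by (intro integral_mono ind_int g_int) (auto simp: indicator_def not_less)
  have "(LBINT r. g r) = 0"
    unfolding g_def using \<phi>_int shift_int lborel_integral_real_affine[of 1 ?\<phi> "- y"] by simp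
  moreover have "(LBINT r. g r) = (LBINT r. indicator B r * g r + indicator (- B) r * g r)"
    by (intro Bochner_Integration.integral_cong) (auto simp: indicator_def)
  ultimately have "(LBINT r. indicator (- B) r * g r) = - (LBINT r. indicator B r * g r)"
    using ind_int[OF g_int, of B] ind_int[OF g_int, of "- B"] by simp
  with upper[of B] upper[of "- B"] have "\<bar>LBINT r. indicator B r * g r\<bar> \<le> K" by simp
  moreover have "K \<le> y / s"
  proof -
    have "K = (LBINT r. indicator {y / 2<..} r * ?\<phi> (r - y)) - (LBINT r. indicator {y / 2<..} r * ?\<phi> r)"
      unfolding K_def g_def using ind_int[OF \<phi>_int] ind_int[OF shift_int] by (simp add: right_diff_distrib)
    also have "(LBINT r. indicator {y / 2<..} r * ?\<phi> (r - y)) = (LBINT r. indicator {- y / 2<..} r * ?\<phi> r)"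
    proof -
      have "(LBINT r. indicator {y / 2<..} r * ?\<phi> (r - y)) = (LBINT r. indicator {y / 2<..} (y + r) * ?\<phi> r)"
        using lborel_integral_real_affine[of 1 "\<lambda>r. indicator {y / 2<..} r * ?\<phi> (r - y)" y] by simp
      also have "\<dots> = (LBINT r. indicator {- y / 2<..} r * ?\<phi> r)"
        by (intro Bochner_Integration.integral_cong) (auto simp: indicator_def)
      finally show ?thesis .
    qed
    also have "(LBINT r. indicator {- y / 2<..} r * ?\<phi> r) - (LBINT r. indicator {y / 2<..} r * ?\<phi> r)
        = (LBINT r. indicator {- y / 2<..y / 2} r * ?\<phi> r)"
    proof -
      have "(LBINT r. indicator {- y / 2<..} r * ?\<phi> r) =
          (LBINT r. indicator {- y / 2<..y / 2} r * ?\<phi> r + indicator {y / 2<..} r * ?\<phi> r)"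
        using y by (intro Bochner_Integration.integral_cong) (auto simp: indicator_def)
      also have "\<dots> = (LBINT r. indicator {- y / 2<..y / 2} r * ?\<phi> r) + (LBINT r. indicator {y / 2<..} r * ?\<phi> r)"
        by (intro Bochner_Integration.integral_add ind_int[OF \<phi>_int]) auto
      finally show ?thesis by simp
    qed
    also have "\<dots> \<le> (LBINT r. indicator {- y / 2<..y / 2} r * (1 / s))"
    proof (rule integral_mono)
      show "integrable lborel (\<lambda>r. indicator {- y / 2<..y / 2} r * ?\<phi> r)"
        by (rule ind_int[OF \<phi>_int]) simp
      show "integrable lborel (\<lambda>r. indicator {- y / 2<..y / 2} r * (1 / s))"
        using y by (intro integrable_mult_left integrable_real_indicator) (auto simp: emeasure_lborel_Ioc)
      show "indicator {- y / 2<..y / 2} r * ?\<phi> r \<le> indicator {- y / 2<..y / 2} r * (1 / s)" for r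
        using normal_density_le_inverse[OF s] by (intro mult_left_mono) auto
    qed
    also have "\<dots> = y / s" using y by simp
    finally show ?thesis .
  qed
  ultimately show ?thesis unfolding D g_def by simp
qed

lemma normal_shift_diff_le:
  assumes s: "s > 0" and B[measurable]: "B \<in> sets borel"
  shows "\<bar>(LBINT r. indicator B (r + y) * normal_density 0 s r) - (LBINT r. indicator B r * normal_density 0 s r)\<bar> \<le> \<bar>y\<bar> / s"
proof (cases "y \<ge> 0")
  case True
  then show ?thesis using normal_shift_diff_le_nonneg[OF s True B] by simp
next
  case False
  (* A shift to the left of B is a shift to the right of the translate C. *)
  define C where "C = (\<lambda>r. r + y) -` B"
  have [measurable]: "C \<in> sets borel"
    using measurable_sets[of "\<lambda>r. r + y" borel borel B] B by (simp add: C_def)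
  show ?thesis
    using normal_shift_diff_le_nonneg[OF s _ \<open>C \<in> sets borel\<close>, of "- y"] False
    by (simp add: C_def indicator_def abs_minus_commute)
qed

context prob_space
begin

text \<open>
  Given \<open>X\<close>, the conditional probability of \<open>\<rho> * X + R \<in> B\<close> is
  \<open>q (\<rho> * X)\<close> for a function \<open>q\<close> with Lipschitz constant \<open>1 /
  sqrt w \<le> 2 / sqrt v\<close>. Replacing it by the constant \<open>q 0\<close>, for which the
  covariance vanishes, costs at most \<open>(2 / sqrt v) * \<bar>\<rho>\<bar> * E \<bar>X\<bar>
  \<le> 2 * \<bar>\<rho>\<bar>\<close> in the joint probability and again in the product.
\<close>
lemma indicator_cov_le:
  assumes X: "centred_normal X v" and R: "centred_normal R w" and ind: "indep_var borel X borel R"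
    and v: "v > 0" and w: "w \<ge> v / 4" and B[measurable]: "B \<in> sets borel"
  shows "\<bar>prob {\<omega> \<in> space M. X \<omega> \<in> B \<and> \<rho> * X \<omega> + R \<omega> \<in> B}
      - prob {\<omega> \<in> space M. X \<omega> \<in> B} * prob {\<omega> \<in> space M. \<rho> * X \<omega> + R \<omega> \<in> B}\<bar> \<le> 4 * \<bar>\<rho>\<bar>"
proof -
  note [measurable] = centred_normalD(1)[OF X] centred_normalD(1)[OF R]
  have w0: "w > 0" using v w by linarith
  define \<phi> where "\<phi> = normal_density 0 (sqrt w)"
  define q where "q y = (LBINT r. indicator B (r + y) * \<phi> r)" for y :: real
  have distR: "distributed M lborel R \<phi>" unfolding \<phi>_def by (rule centred_normal_distributed[OF R w0])
  have distX: "distributed M lborel X (normal_density 0 (sqrt v))" by (rule centred_normal_distributed[OF X v])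
  have [measurable]: "q \<in> borel_measurable borel"
    unfolding q_def \<phi>_def by measurable
  have q_bounds: "0 \<le> q y" "q y \<le> 1" for y
  proof -
    show "0 \<le> q y" unfolding q_def \<phi>_def by (intro integral_nonneg_AE) auto
    have \<phi>i: "integrable lborel \<phi>" unfolding \<phi>_def using w0 by (intro integrable_normal_density) simp
    have "q y \<le> (LBINT r. \<phi> r)"
      unfolding q_def
    proof (rule integral_mono[OF _ \<phi>i])
      show "integrable lborel (\<lambda>r. indicat_real B (r + y) * \<phi> r)"
        by (rule Bochner_Integration.integrable_bound[OF \<phi>i]) (auto simp: indicator_def \<phi>_def)
    qed (auto simp: indicator_def \<phi>_def)
    also have "\<dots> = 1" unfolding \<phi>_def using w0 by simp
    finally show "q y \<le> 1" .
  qed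
  have q_lip: "\<bar>q y - q 0\<bar> \<le> (2 / sqrt v) * \<bar>y\<bar>" for y
  proof -
    have "\<bar>q y - q 0\<bar> \<le> \<bar>y\<bar> / sqrt w"
      using normal_shift_diff_le[of "sqrt w" B y] w0 by (simp add: q_def \<phi>_def)
    also have "\<dots> \<le> \<bar>y\<bar> / (sqrt v / 2)"
    proof (rule divide_left_mono)
      have "sqrt v / 2 = sqrt (v / 4)" by (simp add: real_sqrt_divide)
      also have "\<dots> \<le> sqrt w" using w by simp
      finally show "sqrt v / 2 \<le> sqrt w" .
    qed (use v w0 in auto)
    finally show ?thesis by (simp add: mult.commute)
  qed
  \<comment> \<open>Integrating out \<open>R\<close> by Fubini.\<close>
  have fubini: "prob {\<omega> \<in> space M. X \<omega> \<in> A \<and> \<rho> * X \<omega> + R \<omega> \<in> B} = expectation (\<lambda>\<omega>. indicator A (X \<omega>) * q (\<rho> * X \<omega>))"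
    if [measurable]: "A \<in> sets borel" for A
  proof -
    interpret X: prob_space "distr M borel X" by (rule prob_space_distr) simp
    interpret R: prob_space "distr M borel R" by (rule prob_space_distr) simp
    interpret P: pair_prob_space "distr M borel X" "distr M borel R" ..
    define F where "F = (\<lambda>(x, r). indicat_real A x * indicat_real B (\<rho> * x + r))"
    have [measurable]: "F \<in> borel_measurable (borel \<Otimes>\<^sub>M borel)" unfolding F_def by measurable
    have "prob {\<omega> \<in> space M. X \<omega> \<in> A \<and> \<rho> * X \<omega> + R \<omega> \<in> B}
      = expectation (indicat_real {\<omega> \<in> space M. X \<omega> \<in> A \<and> \<rho> * X \<omega> + R \<omega> \<in> B})"
      by (subst Bochner_Integration.integral_indicator) (auto intro!: arg_cong[where f = prob])
    also have "\<dots> = expectation (\<lambda>\<omega>. F (X \<omega>, R \<omega>))"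
      by (intro Bochner_Integration.integral_cong) (auto simp: F_def indicator_def)
    also have "\<dots> = integral\<^sup>L (distr M (borel \<Otimes>\<^sub>M borel) (\<lambda>\<omega>. (X \<omega>, R \<omega>))) F"
      by (subst integral_distr) auto
    also have "distr M (borel \<Otimes>\<^sub>M borel) (\<lambda>\<omega>. (X \<omega>, R \<omega>)) = distr M borel X \<Otimes>\<^sub>M distr M borel R"
      using ind unfolding indep_var_distribution_eq by simp
    also have "integral\<^sup>L \<dots> F = (\<integral>x. (\<integral>r. F (x, r) \<partial>distr M borel R) \<partial>distr M borel X)"
    proof (rule P.integral_fst'[symmetric])
      show "integrable (distr M borel X \<Otimes>\<^sub>M distr M borel R) F"
        by (rule P.integrable_const_bound[of _ 1]) (auto simp: F_def indicator_def split: prod.split)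
    qed
    also have "\<dots> = (\<integral>x. indicator A x * q (\<rho> * x) \<partial>distr M borel X)"
    proof (rule Bochner_Integration.integral_cong[OF refl])
      fix x
      have "(\<integral>r. F (x, r) \<partial>distr M borel R) = expectation (\<lambda>\<omega>. indicat_real A x * indicat_real B (R \<omega> + \<rho> * x))"
        by (subst integral_distr) (auto simp: F_def add.commute)
      also have "\<dots> = indicat_real A x * expectation (\<lambda>\<omega>. indicat_real B (R \<omega> + \<rho> * x))" by simp
      also have "expectation (\<lambda>\<omega>. indicat_real B (R \<omega> + \<rho> * x)) = q (\<rho> * x)"
        unfolding q_def using distributed_integral[OF distR, of "\<lambda>r. indicat_real B (r + \<rho> * x)"]
        by (simp add: mult.commute \<phi>_def)
      finally show "(\<integral>r. F (x, r) \<partial>distr M borel R) = indicator A x * q (\<rho> * x)" .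
    qed
    also have "\<dots> = expectation (\<lambda>\<omega>. indicator A (X \<omega>) * q (\<rho> * X \<omega>))"
      by (subst integral_distr) auto
    finally show ?thesis .
  qed
  define d where "d \<omega> = q (\<rho> * X \<omega>) - q 0" for \<omega>
  have [measurable]: "d \<in> borel_measurable M" unfolding d_def by measurable
  have d1: "\<bar>d \<omega>\<bar> \<le> 1" for \<omega> using q_bounds[of 0] q_bounds[of "\<rho> * X \<omega>"] by (simp add: d_def)
  have d_int: "integrable M d" "integrable M (\<lambda>\<omega>. indicator B (X \<omega>) * d \<omega>)"
    using d1 by (auto intro!: integrable_const_bound[of _ 1] simp: indicator_def)
  have i_int: "integrable M (\<lambda>\<omega>. indicat_real B (X \<omega>))"
    by (auto intro!: integrable_const_bound[of _ 1] simp: indicator_def)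
  define p where "p = expectation (\<lambda>\<omega>. indicat_real B (X \<omega>))"
  have p: "p = prob {\<omega> \<in> space M. X \<omega> \<in> B}"
    unfolding p_def by (rule expectation_indicator_vimage[OF _ B]) simp
  have joint: "prob {\<omega> \<in> space M. X \<omega> \<in> B \<and> \<rho> * X \<omega> + R \<omega> \<in> B} = p * q 0 + expectation (\<lambda>\<omega>. indicator B (X \<omega>) * d \<omega>)"
  proof -
    have "expectation (\<lambda>\<omega>. indicator B (X \<omega>) * q (\<rho> * X \<omega>)) = expectation (\<lambda>\<omega>. indicator B (X \<omega>) * q 0 + indicator B (X \<omega>) * d \<omega>)"
      by (intro Bochner_Integration.integral_cong) (auto simp: d_def algebra_simps)
    then show ?thesis using fubini[OF B] i_int d_int by (simp add: p_def)
  qed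
  have marg: "prob {\<omega> \<in> space M. \<rho> * X \<omega> + R \<omega> \<in> B} = q 0 + expectation d"
  proof -
    have "expectation (\<lambda>\<omega>. q (\<rho> * X \<omega>)) = expectation (\<lambda>\<omega>. q 0 + d \<omega>)"
      by (intro Bochner_Integration.integral_cong) (auto simp: d_def)
    then show ?thesis using fubini[of UNIV] d_int by (simp add: prob_space)
  qed
  have absX: "integrable M (\<lambda>\<omega>. \<bar>X \<omega>\<bar>)" "expectation (\<lambda>\<omega>. \<bar>X \<omega>\<bar>) \<le> sqrt v"
  proof -
    have int2: "integrable M (\<lambda>\<omega>. (X \<omega>)\<^sup>2)"
      using distributed_integrable[OF distX, of "\<lambda>x. x\<^sup>2"] integrable_normal_moment[of "sqrt v" 0 2] v by simp
    have ex2: "expectation (\<lambda>\<omega>. (X \<omega>)\<^sup>2) = v"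
      using normal_distributed_variance[OF _ distX] normal_distributed_expectation[OF _ distX] v by simp
    have bound: "\<bar>x\<bar> \<le> sqrt v / 2 + x\<^sup>2 / (2 * sqrt v)" for x
    proof -
      have "0 \<le> (\<bar>x\<bar> - sqrt v)\<^sup>2 / (2 * sqrt v)" using v by simp
      also have "\<dots> = sqrt v / 2 + x\<^sup>2 / (2 * sqrt v) - \<bar>x\<bar>"
        using v by (simp add: power2_diff field_simps)
      finally show ?thesis by simp
    qed
    have int3: "integrable M (\<lambda>\<omega>. sqrt v / 2 + (X \<omega>)\<^sup>2 / (2 * sqrt v))" using int2 by simp
    show *: "integrable M (\<lambda>\<omega>. \<bar>X \<omega>\<bar>)"
      by (rule Bochner_Integration.integrable_bound[OF int3]) (use bound v in \<open>auto intro!: order_trans[OF bound]\<close>)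
    have "expectation (\<lambda>\<omega>. \<bar>X \<omega>\<bar>) \<le> expectation (\<lambda>\<omega>. sqrt v / 2 + (X \<omega>)\<^sup>2 / (2 * sqrt v))"
      by (intro integral_mono * int3 bound)
    also have "\<dots> = sqrt v / 2 + v / (2 * sqrt v)" using int2 ex2 by (simp add: prob_space)
    also have "\<dots> = sqrt v" using v by (simp add: field_simps)
    finally show "expectation (\<lambda>\<omega>. \<bar>X \<omega>\<bar>) \<le> sqrt v" .
  qed
  have dabs: "expectation (\<lambda>\<omega>. \<bar>d \<omega>\<bar>) \<le> 2 * \<bar>\<rho>\<bar>"
  proof -
    have "expectation (\<lambda>\<omega>. \<bar>d \<omega>\<bar>) \<le> expectation (\<lambda>\<omega>. (2 / sqrt v * \<bar>\<rho>\<bar>) * \<bar>X \<omega>\<bar>)"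
    proof (intro integral_mono)
      show "\<bar>d \<omega>\<bar> \<le> (2 / sqrt v * \<bar>\<rho>\<bar>) * \<bar>X \<omega>\<bar>" for \<omega>
        using q_lip[of "\<rho> * X \<omega>"] by (simp add: d_def abs_mult mult.assoc)
    qed (use absX(1) d_int in auto)
    also have "\<dots> = (2 / sqrt v * \<bar>\<rho>\<bar>) * expectation (\<lambda>\<omega>. \<bar>X \<omega>\<bar>)" by simp
    also have "\<dots> \<le> (2 / sqrt v * \<bar>\<rho>\<bar>) * sqrt v" using absX(2) v by (intro mult_left_mono) auto
    also have "\<dots> = 2 * \<bar>\<rho>\<bar>" using v by simp
    finally show ?thesis .
  qed
  have "\<bar>expectation (\<lambda>\<omega>. indicator B (X \<omega>) * d \<omega>)\<bar> \<le> expectation (\<lambda>\<omega>. \<bar>indicator B (X \<omega>) * d \<omega>\<bar>)"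
    by (rule integral_abs_bound)
  also have "\<dots> \<le> expectation (\<lambda>\<omega>. \<bar>d \<omega>\<bar>)"
    using d_int by (intro integral_mono) (auto simp: indicator_def)
  finally have 1: "\<bar>expectation (\<lambda>\<omega>. indicator B (X \<omega>) * d \<omega>)\<bar> \<le> 2 * \<bar>\<rho>\<bar>" using dabs by linarith
  have "\<bar>expectation d\<bar> \<le> 2 * \<bar>\<rho>\<bar>"
    using integral_abs_bound[of M d] dabs by linarith
  then have 2: "\<bar>p * expectation d\<bar> \<le> 1 * (2 * \<bar>\<rho>\<bar>)"
    unfolding abs_mult p by (intro mult_mono) auto
  show ?thesis
    using 1 2 unfolding joint marg p[symmetric] by (simp add: distrib_left)
qed

text \<open>
  Gram-Schmidt: subtracting \<open>\<rho> * X\<close> from \<open>Y\<close>, with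
  \<open>\<rho>\<close> the correlation, leaves a linear combination \<open>R\<close> of the
  \<open>\<xi>\<close> that is orthogonal to \<open>X\<close>. All combinations of
  \<open>X\<close> and \<open>R\<close> are normal with additive variances, so the characteristic
  functions factor and \<open>X\<close>, \<open>R\<close> are independent.
\<close>
lemma indicator_cov_linear_combinations_le:
  assumes ind: "indep_vars (\<lambda>_. borel) \<xi> T" and fin: "finite T"
    and \<xi>: "\<And>p. p \<in> T \<Longrightarrow> centred_normal (\<xi> p) v" and v: "v > 0"
    and a: "(\<Sum>p\<in>T. (a p)\<^sup>2) = S" and b: "(\<Sum>p\<in>T. (b p)\<^sup>2) = S" and S: "S > 0"
    and B[measurable]: "B \<in> sets borel"
  defines "X \<equiv> \<lambda>\<omega>. \<Sum>p\<in>T. a p * \<xi> p \<omega>" and "Y \<equiv> \<lambda>\<omega>. \<Sum>p\<in>T. b p * \<xi> p \<omega>"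
  shows "\<bar>prob {\<omega> \<in> space M. X \<omega> \<in> B \<and> Y \<omega> \<in> B}
      - prob {\<omega> \<in> space M. X \<omega> \<in> B} * prob {\<omega> \<in> space M. Y \<omega> \<in> B}\<bar> \<le> 4 * \<bar>\<Sum>p\<in>T. a p * b p\<bar> / S"
proof -
  define \<rho> where "\<rho> = (\<Sum>p\<in>T. a p * b p) / S"
  have comb: "centred_normal (\<lambda>\<omega>. \<Sum>p\<in>T. f p * \<xi> p \<omega>) ((\<Sum>p\<in>T. (f p)\<^sup>2) * v)" for f
    using centred_normal_sum[OF ind fin \<xi>, of f] by (simp add: sum_distrib_right)
  note [measurable] = centred_normalD(1)[OF comb]
  have goal: "4 * \<bar>\<Sum>p\<in>T. a p * b p\<bar> / S = 4 * \<bar>\<rho>\<bar>" using S by (simp add: \<rho>_def)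
  show ?thesis
  proof (cases "\<bar>\<rho>\<bar> \<le> 1 / 2")
    (* For a large correlation the remainder R may be too small to smooth B, but then the bound exceeds 1. *)
    case False
    have "\<bar>x - y * z\<bar> \<le> 1" if "0 \<le> x" "x \<le> 1" "0 \<le> y" "y \<le> 1" "0 \<le> z" "z \<le> 1" for x y z :: real
      using that mult_le_one[of y z] mult_nonneg_nonneg[of y z] by linarith
    then have "\<bar>prob {\<omega> \<in> space M. X \<omega> \<in> B \<and> Y \<omega> \<in> B}
      - prob {\<omega> \<in> space M. X \<omega> \<in> B} * prob {\<omega> \<in> space M. Y \<omega> \<in> B}\<bar> \<le> 1" by simp
    with False show ?thesis unfolding goal by linarith
  next
    case True
    define r where "r p = b p - \<rho> * a p" for p
    define R where "R = (\<lambda>\<omega>. \<Sum>p\<in>T. r p * \<xi> p \<omega>)"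
    have ab: "(\<Sum>p\<in>T. a p * b p) = \<rho> * S" using S by (simp add: \<rho>_def)
    have ra: "(\<Sum>p\<in>T. r p * a p) = 0"
    proof -
      have "(\<Sum>p\<in>T. r p * a p) = (\<Sum>p\<in>T. a p * b p) - \<rho> * (\<Sum>p\<in>T. (a p)\<^sup>2)"
        by (simp add: r_def sum_distrib_left sum_subtractf[symmetric] power2_eq_square algebra_simps)
      then show ?thesis using a ab by simp
    qed
    have rr: "(\<Sum>p\<in>T. (r p)\<^sup>2) = S * (1 - \<rho>\<^sup>2)"
    proof -
      have "(\<Sum>p\<in>T. (r p)\<^sup>2) = (\<Sum>p\<in>T. (b p)\<^sup>2) - 2 * \<rho> * (\<Sum>p\<in>T. a p * b p) + \<rho>\<^sup>2 * (\<Sum>p\<in>T. (a p)\<^sup>2)"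
        by (simp add: r_def sum_distrib_left sum_subtractf[symmetric] sum.distrib[symmetric] power2_eq_square algebra_simps)
      then show ?thesis using a b ab by (simp add: power2_eq_square algebra_simps)
    qed
    have X: "centred_normal X (S * v)" and R: "centred_normal R (S * (1 - \<rho>\<^sup>2) * v)"
      using comb[of a] comb[of r] unfolding X_def R_def a rr by auto
    note [measurable] = centred_normalD(1)[OF X] centred_normalD(1)[OF R]
    have "indep_var borel X borel R"
    proof (rule indep_var_if_char_factors)
      fix s t
      have "(\<lambda>\<omega>. s * X \<omega> + t * R \<omega>) = (\<lambda>\<omega>. \<Sum>p\<in>T. (s * a p + t * r p) * \<xi> p \<omega>)"
        by (simp add: X_def R_def sum_distrib_left sum.distrib[symmetric] algebra_simps)
      moreover have "(\<Sum>p\<in>T. (s * a p + t * r p)\<^sup>2) = s\<^sup>2 * S + t\<^sup>2 * (S * (1 - \<rho>\<^sup>2))"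
      proof -
        have "(\<Sum>p\<in>T. (s * a p + t * r p)\<^sup>2)
            = s\<^sup>2 * (\<Sum>p\<in>T. (a p)\<^sup>2) + 2 * s * t * (\<Sum>p\<in>T. r p * a p) + t\<^sup>2 * (\<Sum>p\<in>T. (r p)\<^sup>2)"
          by (simp add: sum_distrib_left sum.distrib[symmetric] power2_eq_square algebra_simps)
        then show ?thesis by (simp add: a ra rr)
      qed
      ultimately have "centred_normal (\<lambda>\<omega>. s * X \<omega> + t * R \<omega>) ((s\<^sup>2 * S + t\<^sup>2 * (S * (1 - \<rho>\<^sup>2))) * v)"
        using comb[of "\<lambda>p. s * a p + t * r p"] by simp
      from centred_normalD[OF this]
      have "(CLINT \<omega>|M. iexp (s * X \<omega> + t * R \<omega>)) = complex_of_real (exp (- ((s\<^sup>2 * S + t\<^sup>2 * (S * (1 - \<rho>\<^sup>2))) * v) / 2))"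
        using char_distr[of "\<lambda>\<omega>. s * X \<omega> + t * R \<omega>" 1] by (metis (no_types, lifting) mult_1 mult_1_right power_one Bochner_Integration.integral_cong)
      also have "\<dots> = complex_of_real (exp (- (S * v) * s\<^sup>2 / 2)) * complex_of_real (exp (- (S * (1 - \<rho>\<^sup>2) * v) * t\<^sup>2 / 2))"
        unfolding of_real_mult[symmetric] exp_add[symmetric] by (intro arg_cong[where f = "\<lambda>x. complex_of_real (exp x)"]) (simp add: field_simps)
      also have "\<dots> = (CLINT \<omega>|M. iexp (s * X \<omega>)) * (CLINT \<omega>|M. iexp (t * R \<omega>))"
        using centred_normalD(2)[OF X] centred_normalD(2)[OF R] char_distr[of X] char_distr[of R] by simp
      finally show "(CLINT \<omega>|M. iexp (s * X \<omega> + t * R \<omega>)) = (CLINT \<omega>|M. iexp (s * X \<omega>)) * (CLINT \<omega>|M. iexp (t * R \<omega>))" .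
    qed auto
    moreover have "S * (1 - \<rho>\<^sup>2) * v \<ge> S * v / 4"
    proof -
      have "\<rho>\<^sup>2 \<le> (1 / 2)\<^sup>2" using True by (intro abs_le_square_iff[THEN iffD1]) auto
      then have "(S * v) * (1 / 4) \<le> (S * v) * (1 - \<rho>\<^sup>2)"
        using S v by (intro mult_left_mono) (auto simp: power2_eq_square)
      then show ?thesis by (simp add: mult_ac)
    qed
    ultimately have "\<bar>prob {\<omega> \<in> space M. X \<omega> \<in> B \<and> \<rho> * X \<omega> + R \<omega> \<in> B}
      - prob {\<omega> \<in> space M. X \<omega> \<in> B} * prob {\<omega> \<in> space M. \<rho> * X \<omega> + R \<omega> \<in> B}\<bar> \<le> 4 * \<bar>\<rho>\<bar>"
      using S v by (intro indicator_cov_le[OF X R]) auto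
    moreover have "Y \<omega> = \<rho> * X \<omega> + R \<omega>" for \<omega>
      by (simp add: X_def Y_def R_def r_def sum_distrib_left sum.distrib[symmetric] algebra_simps)
    ultimately show ?thesis unfolding goal by simp
  qed
qed

end

section \<open>Exponentially weighted Riemann-Stieltjes sums and the motion between branching times\<close>

text \<open>
  Riemann-Stieltjes sums for the integral of \<open>exp (- c * (a + 1 - s))\<close> against
  \<open>f\<close> over \<open>{a..<a + 1}\<close>. The grid has mesh \<open>1 / Suc n\<close> and
  its last cell is left out, so that only values of \<open>f\<close> before time \<open>a +
  1\<close> are used: the driving motions are given on half-open intervals.
\<close>
definition ou_sum :: "real \<Rightarrow> real \<Rightarrow> nat \<Rightarrow> (real \<Rightarrow> real) \<Rightarrow> real" where
  "ou_sum c a n f = (\<Sum>j<n. exp (- c * (1 - real (Suc j) / real (Suc n)))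
     * (f (a + real (Suc j) / real (Suc n)) - f (a + real j / real (Suc n))))"

lemma integral_exp_weight:
  fixes a u v :: real
  assumes "u \<le> v"
  shows "((\<lambda>s. c * exp (- c * (a + 1 - s))) has_integral (exp (- c * (a + 1 - v)) - exp (- c * (a + 1 - u)))) {u..v}"
  by (rule fundamental_theorem_of_calculus[OF assms])
     (auto intro!: derivative_eq_intros simp: has_real_derivative_iff_has_vector_derivative[symmetric])

text \<open>
  Summation by parts moves the increments from \<open>F\<close> to the smooth weight. What remains
  is a Riemann sum of a continuous function, and the missing last cell contributes a single
  increment of \<open>F\<close>, which tends to 0.
\<close>
lemma ou_sum_tendsto:
  assumes c: "c > 0" and F: "continuous_on {a..a + 1} F"
  shows "(\<lambda>n. ou_sum c a n F) \<longlonglongrightarrow> F (a + 1) - exp (- c) * F a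
           - integral {a..a + 1} (\<lambda>s. c * exp (- c * (a + 1 - s)) * F s)"
proof -
  define w where "w s = exp (- c * (a + 1 - s))" for s
  define t where "t n j = a + real j / real (Suc n)" for n j :: nat
  have t0: "t n 0 = a" and t1: "t n (Suc n) = a + 1" and t_step: "t n j \<le> t n (Suc j)"
    and t_diff: "t n (Suc j) - t n j = 1 / real (Suc n)" for n j
    by (auto simp: t_def divide_right_mono diff_divide_distrib[symmetric])
  have t_mem: "t n j \<in> {a..a + 1}" if "j \<le> Suc n" for n j
    using that by (auto simp: t_def divide_le_eq)
  have w_t: "w (t n j) = exp (- c * (1 - real j / real (Suc n)))" for n j
    by (simp add: w_def t_def)
  have wcont: "continuous_on X w" for X unfolding w_def by (intro continuous_intros)
  define full where "full n = (\<Sum>j<Suc n. w (t n (Suc j)) * (F (t n (Suc j)) - F (t n j)))" for n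
  define left where "left n = (\<Sum>j<Suc n. F (t n j) * (w (t n (Suc j)) - w (t n j)))" for n
  let ?I = "integral {a..a + 1} (\<lambda>s. c * w s * F s)"
  have abel: "full n = w (a + 1) * F (a + 1) - w a * F a - left n" for n
  proof -
    have "full n + left n = (\<Sum>j<Suc n. w (t n (Suc j)) * F (t n (Suc j)) - w (t n j) * F (t n j))"
      unfolding full_def left_def sum.distrib[symmetric] by (intro sum.cong refl) (simp add: algebra_simps)
    also have "\<dots> = w (t n (Suc n)) * F (t n (Suc n)) - w (t n 0) * F (t n 0)"
      by (rule sum_lessThan_telescope)
    finally show ?thesis unfolding t0 t1 by simp
  qed
  have uc: "uniformly_continuous_on {a..a + 1} F"
    using F by (rule compact_uniformly_continuous) simp
  have mesh: "\<forall>\<^sub>F n in sequentially. \<forall>x\<in>{a..a + 1}. \<forall>y\<in>{a..a + 1}. \<bar>x - y\<bar> \<le> 1 / real (Suc n) \<longrightarrow> \<bar>F x - F y\<bar> < e"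
    if e: "e > 0" for e
  proof -
    obtain d where d: "d > 0" "\<And>x y. x \<in> {a..a + 1} \<Longrightarrow> y \<in> {a..a + 1} \<Longrightarrow> dist y x < d \<Longrightarrow> dist (F y) (F x) < e"
      using uc e unfolding uniformly_continuous_on_def by metis
    have "(\<lambda>n. 1 / real (Suc n)) \<longlonglongrightarrow> 0"
      using LIMSEQ_inverse_real_of_nat by (simp add: inverse_eq_divide)
    then have "\<forall>\<^sub>F n in sequentially. 1 / real (Suc n) < d"
      using d(1) by (rule order_tendstoD(2))
    then show ?thesis
      by eventually_elim (use d(2) in \<open>fastforce simp: dist_real_def\<close>)
  qed
  have left_lim: "left \<longlonglongrightarrow> ?I"
  proof (rule LIMSEQ_I)
    fix e :: real assume e: "e > 0"
    have "\<forall>\<^sub>F n in sequentially. \<bar>left n - ?I\<bar> < e"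
      using mesh[OF e]
    proof eventually_elim
      case (elim n)
      have int: "(\<lambda>s. c * w s * F s) integrable_on {u..v}" if "a \<le> u" "v \<le> a + 1" for u v
        using that F wcont
        by (intro integrable_continuous_real continuous_intros) (auto intro: continuous_on_subset)
      (* Each cell contributes an error of at most e times the increase of w, and w increases by less than 1 in total. *)
      have "\<bar>(\<Sum>j<k. F (t n j) * (w (t n (Suc j)) - w (t n j))) - integral {a..t n k} (\<lambda>s. c * w s * F s)\<bar>
          \<le> e * (w (t n k) - w a)" if "k \<le> Suc n" for k
        using that
      proof (induction k)
        case 0
        then show ?case by (simp add: t0)
      next
        case (Suc k)
        let ?u = "t n k" and ?v = "t n (Suc k)"
        have mem: "?u \<in> {a..a + 1}" "?v \<in> {a..a + 1}" using Suc.prems by (auto simp del: atLeastAtMost_iff intro!: t_mem)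
        have W: "((\<lambda>s. c * w s) has_integral (w ?v - w ?u)) {?u..?v}"
          using integral_exp_weight[OF t_step, of c a n k] unfolding w_def .
        have J: "((\<lambda>s. c * w s * F s) has_integral integral {?u..?v} (\<lambda>s. c * w s * F s)) {?u..?v}"
          using mem by (intro integrable_integral int) auto
        have D: "((\<lambda>s. c * w s * F s - c * w s * F ?u) has_integral
            (integral {?u..?v} (\<lambda>s. c * w s * F s) - (w ?v - w ?u) * F ?u)) {?u..?v}"
          by (intro has_integral_diff J has_integral_mult_left W)
        have E: "((\<lambda>s. c * w s * e) has_integral ((w ?v - w ?u) * e)) {?u..?v}"
          by (intro has_integral_mult_left W)
        have "norm (integral {?u..?v} (\<lambda>s. c * w s * F s - c * w s * F ?u)) \<le> integral {?u..?v} (\<lambda>s. c * w s * e)"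
        proof (rule integral_norm_bound_integral)
          show "(\<lambda>s. c * w s * F s - c * w s * F ?u) integrable_on {?u..?v}" using D by (rule has_integral_integrable)
          show "(\<lambda>s. c * w s * e) integrable_on {?u..?v}" using E by (rule has_integral_integrable)
          fix s assume s: "s \<in> {?u..?v}"
          have "\<bar>F s - F ?u\<bar> < e"
            using elim[rule_format, of s ?u] s mem t_diff[of n k] by auto
          then have "(c * w s) * \<bar>F s - F ?u\<bar> \<le> (c * w s) * e"
            using c by (intro mult_left_mono) (auto simp: w_def)
          then show "norm (c * w s * F s - c * w s * F ?u) \<le> c * w s * e"
            using c by (simp add: right_diff_distrib[symmetric] abs_mult w_def)
        qed
        then have step: "\<bar>integral {?u..?v} (\<lambda>s. c * w s * F s) - (w ?v - w ?u) * F ?u\<bar> \<le> (w ?v - w ?u) * e"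
          unfolding integral_unique[OF D] integral_unique[OF E] by simp
        have comb: "integral {a..?u} (\<lambda>s. c * w s * F s) + integral {?u..?v} (\<lambda>s. c * w s * F s) = integral {a..?v} (\<lambda>s. c * w s * F s)"
          using mem t_step by (intro Henstock_Kurzweil_Integration.integral_combine int) auto
        show ?case
          using Suc.IH Suc.prems step unfolding comb[symmetric] by (simp add: algebra_simps)
      qed
      from this[of "Suc n"] have "\<bar>left n - ?I\<bar> \<le> e * (1 - w a)"
        by (simp add: left_def t1 w_def)
      also have "\<dots> < e" using e c by (simp add: w_def)
      finally show ?case .
    qed
    then show "\<exists>no. \<forall>n\<ge>no. norm (left n - ?I) < e"
      unfolding eventually_sequentially by simp
  qed
  have last_lim: "(\<lambda>n. F (a + 1) - F (t n n)) \<longlonglongrightarrow> 0"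
  proof (rule LIMSEQ_I)
    fix e :: real assume "e > 0"
    from mesh[OF this] have "\<forall>\<^sub>F n in sequentially. \<bar>F (a + 1) - F (t n n)\<bar> < e"
    proof eventually_elim
      case (elim n)
      show ?case using elim[rule_format, of "a + 1" "t n n"] t_mem[of n n] t_diff[of n n] t1[of n] by auto
    qed
    then show "\<exists>no. \<forall>n\<ge>no. norm (F (a + 1) - F (t n n) - 0) < e"
      unfolding eventually_sequentially by simp
  qed
  have "ou_sum c a n F = full n - (F (a + 1) - F (t n n))" for n
  proof -
    have "full n = (\<Sum>j<n. w (t n (Suc j)) * (F (t n (Suc j)) - F (t n j))) + (F (a + 1) - F (t n n))"
      unfolding full_def by (simp add: t1 w_def)
    moreover have "ou_sum c a n F = (\<Sum>j<n. w (t n (Suc j)) * (F (t n (Suc j)) - F (t n j)))"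
      unfolding ou_sum_def w_t by (simp add: t_def)
    ultimately show ?thesis by simp
  qed
  then have "(\<lambda>n. ou_sum c a n F) = (\<lambda>n. (w (a + 1) * F (a + 1) - w a * F a - left n) - (F (a + 1) - F (t n n)))"
    using abel by simp
  moreover have "\<dots> \<longlonglongrightarrow> (w (a + 1) * F (a + 1) - w a * F a - ?I) - 0"
    by (intro tendsto_diff tendsto_const left_lim last_lim)
  ultimately show ?thesis by (simp add: w_def)
qed

text \<open>
  Variation of constants for \<open>dy = - c * y dt + dF\<close>: the weighted integral of the
  forcing is the final value minus the discounted initial value.
\<close>
lemma ou_sum_tendsto_solution:
  assumes c: "c > 0" and y: "continuous_on {a..a + 1} y"
    and F: "\<And>t. t \<in> {a..<a + 1} \<Longrightarrow> F t = y t + c * integral {a..t} y + k"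
  shows "(\<lambda>n. ou_sum c a n F) \<longlonglongrightarrow> y (a + 1) - exp (- c) * y a"
proof -
  define G where "G t = y t + c * integral {a..t} y + k" for t
  have eq: "ou_sum c a n F = ou_sum c a n G" for n
    unfolding ou_sum_def
    by (intro sum.cong refl arg_cong2[where f = "(*)"] arg_cong2[where f = "(-)"])
       (auto simp: G_def divide_less_eq intro!: F)
  have I: "continuous_on {a..a + 1} (\<lambda>t. integral {a..t} y)"
    by (intro indefinite_integral_continuous_1 integrable_continuous_real y)
  have G: "continuous_on {a..a + 1} G"
    unfolding G_def by (intro continuous_intros y I)
  have "((\<lambda>s. c * exp (- c * (a + 1 - s)) * G s) has_integral
      (exp (- c * (a + 1 - (a + 1))) * (c * integral {a..a + 1} y + k) - exp (- c * (a + 1 - a)) * (c * integral {a..a} y + k))) {a..a + 1}"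
  proof (rule fundamental_theorem_of_calculus)
    fix t assume t: "t \<in> {a..a + 1}"
    have I': "((\<lambda>t. integral {a..t} y) has_real_derivative y t) (at t within {a..a + 1})"
      by (rule integral_has_real_derivative[OF y t])
    show "((\<lambda>t. exp (- c * (a + 1 - t)) * (c * integral {a..t} y + k)) has_vector_derivative
        c * exp (- c * (a + 1 - t)) * G t) (at t within {a..a + 1})"
      unfolding has_real_derivative_iff_has_vector_derivative[symmetric]
      by (rule derivative_eq_intros I' refl)+ (simp add: G_def algebra_simps)
  qed simp
  then have "integral {a..a + 1} (\<lambda>s. c * exp (- c * (a + 1 - s)) * G s)
      = G (a + 1) - y (a + 1) - exp (- c) * (G a - y a)"
    by (subst integral_unique) (auto simp: G_def)
  then have *: "G (a + 1) - exp (- c) * G a - integral {a..a + 1} (\<lambda>s. c * exp (- c * (a + 1 - s)) * G s)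
      = y (a + 1) - exp (- c) * y a"
    by (simp add: right_diff_distrib)
  show ?thesis
    unfolding eq using ou_sum_tendsto[OF c G] unfolding * .
qed

lemma ou_sum_cong:
  assumes "\<And>t. t \<in> {a..<a + 1} \<Longrightarrow> f t = g t"
  shows "ou_sum c a n f = ou_sum c a n g"
  unfolding ou_sum_def
  by (intro sum.cong refl arg_cong2[where f = "(*)"] arg_cong2[where f = "(-)"] assms)
     (auto simp: divide_less_eq)

lemma ou_sum_diff_scaled: "ou_sum c a n (\<lambda>t. f t - r * g t) = ou_sum c a n f - r * ou_sum c a n g"
  unfolding ou_sum_def sum_distrib_left sum_subtractf[symmetric]
  by (intro sum.cong refl) (simp only: algebra_simps)

lemma ou_sum_sum: "ou_sum c a n (\<lambda>t. \<Sum>j\<in>J. g j t) = (\<Sum>j\<in>J. ou_sum c a n (g j))"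
  unfolding ou_sum_def by (subst sum.swap) (simp only: sum_distrib_left[symmetric] sum_subtractf)

lemma continuous_on_closed_extension:
  fixes z :: "real \<Rightarrow> real"
  assumes z: "continuous_on {a..<b} z" and lim: "(z \<longlongrightarrow> l) (at_left b)" and "a < b"
  shows "continuous_on {a..b} (\<lambda>t. if t = b then l else z t)" (is "continuous_on _ ?f")
  unfolding continuous_on_def
proof
  fix x assume x: "x \<in> {a..b}"
  show "(?f \<longlongrightarrow> ?f x) (at x within {a..b})"
  proof (cases "x = b")
    case True
    have "(?f \<longlongrightarrow> l) (at_left b)"
      by (rule Lim_transform_eventually[OF lim]) (auto simp: eventually_at_filter)
    then show ?thesis using True at_within_Icc_at_left[OF \<open>a < b\<close>] by simp
  next
    case False
    with x have xb: "x < b" by simp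
    have "at x within {a..b} = at x within {a..<b}"
      by (rule at_within_nhd[of x "{..<b}"]) (use xb in auto)
    moreover have "(z \<longlongrightarrow> z x) (at x within {a..<b})"
      using z x xb by (auto simp: continuous_on_def)
    moreover have "\<forall>\<^sub>F t in at x within {a..<b}. z t = ?f t"
      by (auto simp: eventually_at_filter)
    ultimately show ?thesis
      using False by (auto intro: Lim_transform_eventually)
  qed
qed

text \<open>
  The mean drift is \<open>- b\<close> times the mean position, so the deviation from the mean
  obeys a linear equation of rate \<open>\<gamma> + b\<close> forced by the centred motions. Each
  single sum over \<open>w i\<close> converges too, because the equation expresses \<open>w
  i\<close> through the positions and thereby extends it continuously to the right end point.
\<close>
lemma relative_motion_over_unit_interval:
  fixes z w :: "'i \<Rightarrow> real \<Rightarrow> real"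
  assumes c: "\<gamma> + b > 0" and I: "finite I" "I \<noteq> {}" and r: "r = 1 / real (card I)"
    and cont: "\<And>i. i \<in> I \<Longrightarrow> continuous_on {a..<a + 1} (z i)"
    and lim: "\<And>i. i \<in> I \<Longrightarrow> (z i \<longlongrightarrow> L i) (at_left (a + 1))"
    and sde: "\<And>i t. i \<in> I \<Longrightarrow> t \<in> {a..<a + 1} \<Longrightarrow> z i t = z i a + (w i t - w i a)
       + integral {a..t} (\<lambda>s. - b * z i s + r * (\<Sum>j\<in>I. \<gamma> * (z j s - z i s)))"
  defines "x \<equiv> \<lambda>i. lim (\<lambda>n. ou_sum (\<gamma> + b) a n (w i))"
  shows "\<And>i. i \<in> I \<Longrightarrow> (\<lambda>n. ou_sum (\<gamma> + b) a n (w i)) \<longlonglongrightarrow> x i"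
    and "\<And>i. i \<in> I \<Longrightarrow> L i - r * (\<Sum>j\<in>I. L j)
       = exp (- (\<gamma> + b)) * (z i a - r * (\<Sum>j\<in>I. z j a)) + x i - r * (\<Sum>j\<in>I. x j)"
proof -
  define y where "y i t = (if t = a + 1 then L i else z i t)" for i t
  have y_z: "y i t = z i t" if "t < a + 1" for i t using that by (simp add: y_def)
  have y_cont: "continuous_on {a..a + 1} (y i)" if "i \<in> I" for i
    unfolding y_def by (intro continuous_on_closed_extension cont lim that) simp
  define m where "m t = r * (\<Sum>j\<in>I. y j t)" for t
  have m_cont: "continuous_on {a..a + 1} m" unfolding m_def by (intro continuous_intros y_cont)
  define h where "h i s = \<gamma> * m s - (\<gamma> + b) * y i s" for i s
  have h_cont: "continuous_on {a..a + 1} (h i)" if "i \<in> I" for i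
    unfolding h_def by (intro continuous_intros y_cont m_cont that)
  have rI: "r * real (card I) = 1" using I r by simp
  have w_eq: "w i t = y i t - integral {a..t} (h i) + (w i a - y i a)" if i: "i \<in> I" and t: "t \<in> {a..<a + 1}" for i t
  proof -
    have "integral {a..t} (\<lambda>s. - b * z i s + r * (\<Sum>j\<in>I. \<gamma> * (z j s - z i s))) = integral {a..t} (h i)"
    proof (rule Henstock_Kurzweil_Integration.integral_cong)
      fix s assume "s \<in> {a..t}"
      then have s: "s < a + 1" using t by simp
      have "r * (\<Sum>j\<in>I. \<gamma> * (z j s - z i s)) = \<gamma> * (r * (\<Sum>j\<in>I. z j s)) - \<gamma> * z i s * (r * real (card I))"
        by (simp add: sum_distrib_left[symmetric] sum_subtractf algebra_simps)
      then show "- b * z i s + r * (\<Sum>j\<in>I. \<gamma> * (z j s - z i s)) = h i s"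
        unfolding rI h_def m_def using s by (simp add: y_z algebra_simps)
    qed
    then show ?thesis using sde[OF i t] t by (simp add: y_z)
  qed
  have int_cont: "continuous_on {a..a + 1} (\<lambda>t. integral {a..t} (h i))" if "i \<in> I" for i
    by (intro indefinite_integral_continuous_1 integrable_continuous_real h_cont that)
  show x_lim: "(\<lambda>n. ou_sum (\<gamma> + b) a n (w i)) \<longlonglongrightarrow> x i" if i: "i \<in> I" for i
  proof -
    have "continuous_on {a..a + 1} (\<lambda>t. y i t - integral {a..t} (h i) + (w i a - y i a))"
      by (intro continuous_intros y_cont int_cont i)
    from ou_sum_tendsto[OF c this] have "convergent (\<lambda>n. ou_sum (\<gamma> + b) a n (\<lambda>t. y i t - integral {a..t} (h i) + (w i a - y i a)))"
      by (auto simp: convergent_def)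
    also have "(\<lambda>n. ou_sum (\<gamma> + b) a n (\<lambda>t. y i t - integral {a..t} (h i) + (w i a - y i a))) = (\<lambda>n. ou_sum (\<gamma> + b) a n (w i))"
      by (intro ext ou_sum_cong w_eq[symmetric] i)
    finally show ?thesis by (simp add: convergent_LIMSEQ_iff x_def)
  qed
  show "L i - r * (\<Sum>j\<in>I. L j)
       = exp (- (\<gamma> + b)) * (z i a - r * (\<Sum>j\<in>I. z j a)) + x i - r * (\<Sum>j\<in>I. x j)" if i: "i \<in> I" for i
  proof -
    define u where "u t = y i t - m t" for t
    have u_cont: "continuous_on {a..a + 1} u" unfolding u_def by (intro continuous_intros y_cont m_cont i)
    have "w i t - r * (\<Sum>j\<in>I. w j t) = u t + (\<gamma> + b) * integral {a..t} u + (w i a - r * (\<Sum>j\<in>I. w j a) - u a)"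
      if t: "t \<in> {a..<a + 1}" for t
    proof -
      have h_int: "h j integrable_on {a..t}" if "j \<in> I" for j
        using t by (intro integrable_continuous_real continuous_on_subset[OF h_cont[OF that]]) auto
      have "r * (\<Sum>j\<in>I. w j t) = r * (\<Sum>j\<in>I. y j t - integral {a..t} (h j) + (w j a - y j a))"
        using t by (intro arg_cong2[where f = "(*)"] sum.cong refl w_eq)
      also have "\<dots> = m t - r * (\<Sum>j\<in>I. integral {a..t} (h j)) + r * (\<Sum>j\<in>I. w j a) - m a"
        by (simp add: m_def sum.distrib sum_subtractf algebra_simps)
      also have "r * (\<Sum>j\<in>I. integral {a..t} (h j)) = integral {a..t} (\<lambda>s. r * (\<Sum>j\<in>I. h j s))"
        by (simp add: Henstock_Kurzweil_Integration.integral_sum[OF I(1) h_int])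
      finally have mean: "r * (\<Sum>j\<in>I. w j t) = m t - integral {a..t} (\<lambda>s. r * (\<Sum>j\<in>I. h j s)) + r * (\<Sum>j\<in>I. w j a) - m a" .
      have h_mean: "r * (\<Sum>j\<in>I. h j s) = - b * m s" for s
      proof -
        have "(\<Sum>j\<in>I. h j s) = real (card I) * (\<gamma> * m s) - (\<gamma> + b) * (\<Sum>j\<in>I. y j s)"
          by (simp add: h_def sum_subtractf sum_distrib_left)
        then have "r * (\<Sum>j\<in>I. h j s) = (r * real (card I)) * (\<gamma> * m s) - (\<gamma> + b) * m s"
          by (simp only: m_def) (simp add: right_diff_distrib)
        then show ?thesis unfolding rI by (simp add: algebra_simps)
      qed
      have bm_int: "(\<lambda>s. - b * m s) integrable_on {a..t}"
        using t by (intro integrable_continuous_real continuous_intros continuous_on_subset[OF m_cont]) auto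
      have "integral {a..t} (h i) - integral {a..t} (\<lambda>s. - b * m s) = integral {a..t} (\<lambda>s. h i s - (- b * m s))"
        by (rule Henstock_Kurzweil_Integration.integral_diff[OF h_int[OF i] bm_int, symmetric])
      also have "\<dots> = integral {a..t} (\<lambda>s. - (\<gamma> + b) * u s)"
        by (intro Henstock_Kurzweil_Integration.integral_cong) (simp add: h_def u_def algebra_simps)
      also have "\<dots> = - (\<gamma> + b) * integral {a..t} u" by (rule integral_mult_right)
      finally show ?thesis
        unfolding mean h_mean using w_eq[OF i t] by (simp add: u_def algebra_simps)
    qed
    from ou_sum_tendsto_solution[OF c u_cont, where F = "\<lambda>t. w i t - r * (\<Sum>j\<in>I. w j t)", OF this]
    have "(\<lambda>n. ou_sum (\<gamma> + b) a n (w i) - r * (\<Sum>j\<in>I. ou_sum (\<gamma> + b) a n (w j))) \<longlonglongrightarrow> u (a + 1) - exp (- (\<gamma> + b)) * u a"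
      unfolding ou_sum_diff_scaled ou_sum_sum .
    moreover have "(\<lambda>n. ou_sum (\<gamma> + b) a n (w i) - r * (\<Sum>j\<in>I. ou_sum (\<gamma> + b) a n (w j))) \<longlonglongrightarrow> x i - r * (\<Sum>j\<in>I. x j)"
      by (intro tendsto_intros x_lim i)
    ultimately have "u (a + 1) - exp (- (\<gamma> + b)) * u a = x i - r * (\<Sum>j\<in>I. x j)"
      by (rule LIMSEQ_unique)
    then show ?thesis by (simp add: u_def m_def y_def)
  qed
qed

section \<open>The relative system along a fixed genealogy\<close>

text \<open>
  \<open>g k j\<close> is the parent, at level \<open>k\<close>, of particle \<open>j\<close> at
  level \<open>Suc k\<close>. Only levels up to \<open>m\<close> are constrained, so that finitely
  many genealogies matter at each time.
\<close>
definition binary_genealogy :: "(nat \<Rightarrow> nat \<Rightarrow> nat) \<Rightarrow> nat \<Rightarrow> bool" where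
  "binary_genealogy g m \<longleftrightarrow> (\<forall>k<m. (\<forall>j\<in>{1..2 ^ Suc k}. g k j \<in> {1..2 ^ k}) \<and>
     (\<forall>i\<in>{1..2 ^ k}. card {j \<in> {1..2 ^ Suc k}. g k j = i} = 2))"

lemma binary_genealogy_mono: "binary_genealogy g m \<Longrightarrow> k \<le> m \<Longrightarrow> binary_genealogy g k"
  by (auto simp: binary_genealogy_def)

lemma binary_genealogy_parent:
  "binary_genealogy g (Suc m) \<Longrightarrow> j \<in> {1..2 ^ Suc m} \<Longrightarrow> g m j \<in> {1..2 ^ m}"
  by (auto simp: binary_genealogy_def)

lemma sum_over_offspring:
  fixes h :: "nat \<Rightarrow> real" and p :: "nat \<Rightarrow> nat"
  assumes "\<And>j. j \<in> {1..2 ^ Suc m} \<Longrightarrow> p j \<in> {1..2 ^ m}"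
    and "\<And>i. i \<in> {1..2 ^ m} \<Longrightarrow> card {j \<in> {1..2 ^ Suc m}. p j = i} = 2"
  shows "(\<Sum>j = 1..2 ^ Suc m. h (p j)) = 2 * (\<Sum>i = 1..2 ^ m. h i)"
proof -
  have "(\<Sum>j = 1..2 ^ Suc m. h (p j)) = (\<Sum>i = 1..2 ^ m. \<Sum>j | j \<in> {1..2 ^ Suc m} \<and> p j = i. h (p j))"
    using assms(1) by (intro sum.group[symmetric]) auto
  also have "\<dots> = (\<Sum>i = 1..2 ^ m. \<Sum>j | j \<in> {1..2 ^ Suc m} \<and> p j = i. h i)"
    by (intro sum.cong refl) auto
  also have "\<dots> = (\<Sum>i = 1..2 ^ m. 2 * h i)"
    using assms(2) by (intro sum.cong refl) (simp add: sum_constant del: sum_constant_scaleR)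
  finally show ?thesis by (simp add: sum_distrib_left)
qed

lemma binary_genealogy_sum:
  fixes h :: "nat \<Rightarrow> real"
  assumes "binary_genealogy g (Suc m)"
  shows "(\<Sum>j = 1..2 ^ Suc m. h (g m j)) = 2 * (\<Sum>i = 1..2 ^ m. h i)"
  using assms by (intro sum_over_offspring) (auto simp: binary_genealogy_def)

text \<open>
  The relative positions at integer times as a function of the genealogy \<open>g\<close> and the
  accumulated noises \<open>x\<close>.
\<close>
fun rel_pos :: "real \<Rightarrow> (nat \<Rightarrow> nat \<Rightarrow> nat) \<Rightarrow> (nat \<Rightarrow> nat \<Rightarrow> real) \<Rightarrow> nat \<Rightarrow> nat \<Rightarrow> real" where
  "rel_pos c g x 0 i = 0"
| "rel_pos c g x (Suc m) i = exp (- c) * rel_pos c g x m (g m i) + x m (g m i) - (1 / 2 ^ m) * (\<Sum>l = 1..2 ^ m. x m l)"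

text \<open>
  The coefficient of the noise \<open>x k l\<close> in \<open>rel_pos c g x m i\<close>.
\<close>
fun rel_coeff :: "real \<Rightarrow> (nat \<Rightarrow> nat \<Rightarrow> nat) \<Rightarrow> nat \<Rightarrow> nat \<Rightarrow> nat \<Rightarrow> nat \<Rightarrow> real" where
  "rel_coeff c g 0 i k l = 0"
| "rel_coeff c g (Suc m) i k l =
     (if k = m then of_bool (l = g m i) - 1 / 2 ^ m else exp (- c) * rel_coeff c g m (g m i) k l)"

text \<open>
  The covariance of two relative positions in units of the variance of one noise.
\<close>
fun rel_cov :: "real \<Rightarrow> (nat \<Rightarrow> nat \<Rightarrow> nat) \<Rightarrow> nat \<Rightarrow> nat \<Rightarrow> nat \<Rightarrow> real" where
  "rel_cov c g 0 i j = 0"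
| "rel_cov c g (Suc m) i j =
     (exp (- c))\<^sup>2 * rel_cov c g m (g m i) (g m j) + (of_bool (g m i = g m j) - 1 / 2 ^ m)"

fun rel_var :: "real \<Rightarrow> nat \<Rightarrow> real" where
  "rel_var c 0 = 0"
| "rel_var c (Suc m) = (exp (- c))\<^sup>2 * rel_var c m + (1 - 1 / 2 ^ m)"

lemma rel_pos_cong:
  assumes "binary_genealogy g m" "\<And>k j. k < m \<Longrightarrow> j \<in> {1..2 ^ Suc k} \<Longrightarrow> g k j = g' k j" "i \<in> {1..2 ^ m}"
  shows "rel_pos c g x m i = rel_pos c g' x m i"
  using assms
proof (induction m arbitrary: i)
  case (Suc m)
  have "rel_pos c g x m (g m i) = rel_pos c g' x m (g m i)"
    using Suc.prems binary_genealogy_mono[OF Suc.prems(1)] binary_genealogy_parent[OF Suc.prems(1,3)]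
    by (intro Suc.IH) auto
  moreover have "g m i = g' m i" using Suc.prems(2)[of m i] Suc.prems(3) by simp
  ultimately show ?case by simp
qed simp

lemma rel_pos_eq_sum:
  assumes "binary_genealogy g m" "i \<in> {1..2 ^ m}"
  shows "rel_pos c g x m i = (\<Sum>k<m. \<Sum>l = 1..2 ^ k. rel_coeff c g m i k l * x k l)"
  using assms
proof (induction m arbitrary: i)
  case (Suc m)
  have p: "g m i \<in> {1..2 ^ m}" by (rule binary_genealogy_parent[OF Suc.prems])
  have "(\<Sum>l = 1..2 ^ m. rel_coeff c g (Suc m) i m l * x m l)
      = (\<Sum>l = 1..2 ^ m. (if l = g m i then x m l else 0) - (1 / 2 ^ m) * x m l)"
    by (intro sum.cong refl) (simp add: left_diff_distrib)
  also have "\<dots> = x m (g m i) - (1 / 2 ^ m) * (\<Sum>l = 1..2 ^ m. x m l)"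
    unfolding sum_subtractf sum_distrib_left[symmetric] using p by simp
  finally have last: "(\<Sum>l = 1..2 ^ m. rel_coeff c g (Suc m) i m l * x m l)
      = x m (g m i) - (1 / 2 ^ m) * (\<Sum>l = 1..2 ^ m. x m l)" .
  have "(\<Sum>k<m. \<Sum>l = 1..2 ^ k. rel_coeff c g (Suc m) i k l * x k l)
      = exp (- c) * (\<Sum>k<m. \<Sum>l = 1..2 ^ k. rel_coeff c g m (g m i) k l * x k l)"
    unfolding sum_distrib_left by (intro sum.cong refl) simp
  also have "\<dots> = exp (- c) * rel_pos c g x m (g m i)"
    using Suc.IH[OF binary_genealogy_mono[OF Suc.prems(1)] p] by simp
  finally show ?case using last by (simp del: rel_coeff.simps)
qed simp

text \<open>
  At the last level the two coefficient vectors are the centred unit vectors of the parents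
  \<open>p\<close> and \<open>q\<close>, whose inner product is \<open>[p = q] - 1 / 2 ^
  m\<close>; the earlier levels contribute the discounted covariance of the parents.
\<close>
lemma rel_cov_eq_sum:
  assumes "binary_genealogy g m" "i \<in> {1..2 ^ m}" "j \<in> {1..2 ^ m}"
  shows "(\<Sum>k<m. \<Sum>l = 1..2 ^ k. rel_coeff c g m i k l * rel_coeff c g m j k l) = rel_cov c g m i j"
  using assms
proof (induction m arbitrary: i j)
  case (Suc m)
  have p: "g m i \<in> {1..2 ^ m}" "g m j \<in> {1..2 ^ m}"
    using binary_genealogy_parent[OF Suc.prems(1)] Suc.prems(2,3) by auto
  define r where "r = (1 / 2 ^ m :: real)"
  have "(\<Sum>l = 1..2 ^ m. rel_coeff c g (Suc m) i m l * rel_coeff c g (Suc m) j m l)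
      = (\<Sum>l = 1..2 ^ m. (if l = g m i then of_bool (g m i = g m j) else 0) - (if l = g m i then r else 0)
           - (if l = g m j then r else 0) + r * r)"
  proof (intro sum.cong refl)
    fix l
    show "rel_coeff c g (Suc m) i m l * rel_coeff c g (Suc m) j m l
        = (if l = g m i then of_bool (g m i = g m j) else 0) - (if l = g m i then r else 0)
           - (if l = g m j then r else 0) + r * r"
      unfolding rel_coeff.simps r_def[symmetric]
      by (cases "l = g m i"; cases "l = g m j") (simp_all add: left_diff_distrib right_diff_distrib)
  qed
  also have "\<dots> = of_bool (g m i = g m j) - r - r + 2 ^ m * (r * r)"
    unfolding sum.distrib sum_subtractf using p by simp
  also have "\<dots> = of_bool (g m i = g m j) - 1 / 2 ^ m"
    by (simp add: r_def)
  finally have last: "(\<Sum>l = 1..2 ^ m. rel_coeff c g (Suc m) i m l * rel_coeff c g (Suc m) j m l)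
      = of_bool (g m i = g m j) - 1 / 2 ^ m" .
  have "(\<Sum>k<m. \<Sum>l = 1..2 ^ k. rel_coeff c g (Suc m) i k l * rel_coeff c g (Suc m) j k l)
      = (exp (- c))\<^sup>2 * (\<Sum>k<m. \<Sum>l = 1..2 ^ k. rel_coeff c g m (g m i) k l * rel_coeff c g m (g m j) k l)"
    unfolding sum_distrib_left by (intro sum.cong refl) (simp add: power2_eq_square)
  also have "\<dots> = (exp (- c))\<^sup>2 * rel_cov c g m (g m i) (g m j)"
    using Suc.IH[OF binary_genealogy_mono[OF Suc.prems(1)] p] by simp
  finally show ?case using last by (simp del: rel_coeff.simps)
qed simp

text \<open>
  On the diagonal the recursion sees neither the particle nor the genealogy. This is why all
  relative positions at one level have the same law.
\<close>
lemma rel_cov_self: "rel_cov c g m i i = rel_var c m"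
  by (induction m arbitrary: i) auto

lemma rel_var_nonneg: "rel_var c m \<ge> 0"
proof (induction m)
  case (Suc m)
  then have "(exp (- c))\<^sup>2 * rel_var c m \<ge> 0" by simp
  moreover have "1 / 2 ^ m \<le> (1 :: real)" by simp
  ultimately show ?case unfolding rel_var.simps by linarith
qed simp

lemma rel_var_ge_half:
  assumes "m \<ge> 2"
  shows "rel_var c m \<ge> 1 / 2"
proof -
  define n where "n = m - 2"
  have n: "m = Suc (Suc n)" using assms by (simp add: n_def)
  have "(exp (- c))\<^sup>2 * rel_var c (Suc n) \<ge> 0" using rel_var_nonneg by (intro mult_nonneg_nonneg) auto
  moreover have "1 / 2 ^ Suc n \<le> (1 / 2 :: real)" by (intro divide_left_mono) auto
  ultimately show ?thesis unfolding n rel_var.simps(2)[of c "Suc n"] by linarith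
qed

fun cov_bound :: "real \<Rightarrow> nat \<Rightarrow> real" where
  "cov_bound c 0 = 0"
| "cov_bound c (Suc m) = (exp (- c))\<^sup>2 * cov_bound c m + 2 / 2 ^ m"

text \<open>
  Each pair of parents has exactly four pairs of offspring, so normalising by \<open>4 ^ m\<close>
  turns the sum over pairs into the same average one level earlier. The new term averages to at
  most \<open>2 / 2 ^ m\<close>: half of it from the pairs with a common parent and half from the
  subtracted mean.
\<close>
lemma mean_abs_rel_cov_le:
  assumes "binary_genealogy g m"
  shows "(1 / 4 ^ m) * (\<Sum>i = 1..2 ^ m. \<Sum>j = 1..2 ^ m. \<bar>rel_cov c g m i j\<bar>) \<le> cov_bound c m"
  using assms
proof (induction m)
  case (Suc m)
  define N where "N = (2 ^ m :: real)"
  define C where "C = (\<Sum>i = 1..2 ^ m. \<Sum>j = 1..2 ^ m. \<bar>rel_cov c g m i j\<bar>)"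
  have N: "N > 0" "4 ^ m = N * N" by (simp_all add: N_def power_mult_distrib[symmetric])
  have "(\<Sum>i = 1..2 ^ Suc m. \<Sum>j = 1..2 ^ Suc m. \<bar>rel_cov c g (Suc m) i j\<bar>)
      \<le> (\<Sum>i = 1..2 ^ Suc m. \<Sum>j = 1..2 ^ Suc m. (exp (- c))\<^sup>2 * \<bar>rel_cov c g m (g m i) (g m j)\<bar>
            + (of_bool (g m i = g m j) + 1 / N))"
  proof (intro sum_mono)
    fix i j
    have "\<bar>rel_cov c g (Suc m) i j\<bar> \<le> \<bar>(exp (- c))\<^sup>2 * rel_cov c g m (g m i) (g m j)\<bar> + \<bar>of_bool (g m i = g m j) - 1 / N\<bar>"
      unfolding rel_cov.simps N_def by (rule abs_triangle_ineq)
    also have "\<bar>of_bool (g m i = g m j) - 1 / N\<bar> \<le> of_bool (g m i = g m j) + 1 / N"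
      using N(1) by (auto simp: abs_le_iff)
    finally show "\<bar>rel_cov c g (Suc m) i j\<bar> \<le> (exp (- c))\<^sup>2 * \<bar>rel_cov c g m (g m i) (g m j)\<bar> + (of_bool (g m i = g m j) + 1 / N)"
      by (simp add: abs_mult)
  qed
  also have "\<dots> = (\<Sum>i = 1..2 ^ Suc m. 2 * (\<Sum>q = 1..2 ^ m. (exp (- c))\<^sup>2 * \<bar>rel_cov c g m (g m i) q\<bar>
            + (of_bool (g m i = q) + 1 / N)))"
    by (intro sum.cong refl binary_genealogy_sum[OF Suc.prems])
  also have "\<dots> = 2 * (\<Sum>p = 1..2 ^ m. 2 * (\<Sum>q = 1..2 ^ m. (exp (- c))\<^sup>2 * \<bar>rel_cov c g m p q\<bar>
            + (of_bool (p = q) + 1 / N)))"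
    by (rule binary_genealogy_sum[OF Suc.prems])
  also have "\<dots> = 4 * (\<Sum>p = 1..2 ^ m. (exp (- c))\<^sup>2 * (\<Sum>q = 1..2 ^ m. \<bar>rel_cov c g m p q\<bar>) + 2)"
  proof -
    have "(\<Sum>q = 1..2 ^ m. (exp (- c))\<^sup>2 * \<bar>rel_cov c g m p q\<bar> + (of_bool (p = q) + 1 / N))
        = (exp (- c))\<^sup>2 * (\<Sum>q = 1..2 ^ m. \<bar>rel_cov c g m p q\<bar>) + 2" if "p \<in> {1..2 ^ m}" for p
    proof -
      have "(\<Sum>q = 1..2 ^ m. of_bool (p = q) :: real) = 1"
        using that by (simp add: of_bool_def)
      then show ?thesis by (simp add: sum.distrib sum_distrib_left N_def)
    qed
    then show ?thesis by (simp add: sum_distrib_left)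
  qed
  also have "\<dots> = 4 * ((exp (- c))\<^sup>2 * C + 2 * N)"
    by (simp add: C_def sum.distrib sum_distrib_left N_def)
  finally have "(1 / 4 ^ Suc m) * (\<Sum>i = 1..2 ^ Suc m. \<Sum>j = 1..2 ^ Suc m. \<bar>rel_cov c g (Suc m) i j\<bar>)
      \<le> (1 / 4 ^ Suc m) * (4 * ((exp (- c))\<^sup>2 * C + 2 * N))"
    by (intro mult_left_mono) auto
  also have "\<dots> = (exp (- c))\<^sup>2 * ((1 / 4 ^ m) * C) + 2 / N"
    using N(1) by (simp add: N(2) field_simps)
  also have "\<dots> \<le> (exp (- c))\<^sup>2 * cov_bound c m + 2 / N"
    using Suc.IH[OF binary_genealogy_mono[OF Suc.prems]] unfolding C_def by (intro add_right_mono mult_left_mono) auto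
  finally show ?case by (simp add: N_def)
qed simp

lemma cov_bound_nonneg: "cov_bound c m \<ge> 0"
  by (induction m) auto

text \<open>
  Summing the recursion gives \<open>S \<le> q * S + 4\<close> for the partial sums, with \<open>q
  = exp (- 2 * c) < 1\<close>.
\<close>
lemma summable_cov_bound:
  assumes "c > 0"
  shows "summable (cov_bound c)"
proof -
  define q where "q = (exp (- c))\<^sup>2"
  have q: "0 < q" "q < 1" using assms by (simp_all add: q_def power_less_one_iff)
  have geo: "(\<Sum>m<n. 2 / 2 ^ m) \<le> (4::real)" for n
  proof -
    have "(\<Sum>m<n. 2 / 2 ^ m) = 4 - 4 / (2 ^ n :: real)" by (induction n) (auto simp: field_simps)
    then show ?thesis by simp
  qed
  have bound: "(\<Sum>m<n. cov_bound c m) \<le> 4 / (1 - q)" for n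
  proof (induction n)
    case 0
    then show ?case using q by simp
  next
    case (Suc n)
    have "(\<Sum>m<Suc n. cov_bound c m) = q * (\<Sum>m<n. cov_bound c m) + (\<Sum>m<n. 2 / 2 ^ m)"
      by (simp add: sum.lessThan_Suc_shift sum.distrib sum_distrib_left q_def del: sum.lessThan_Suc)
    also have "\<dots> \<le> q * (4 / (1 - q)) + 4"
      using Suc.IH q geo by (intro add_mono mult_left_mono) auto
    also have "\<dots> = 4 / (1 - q)" using q by (simp add: field_simps)
    finally show ?case .
  qed
  show ?thesis
    by (rule summableI_nonneg_bounded[OF cov_bound_nonneg bound])
qed

section \<open>Empirical measure along a fixed genealogy\<close>

context prob_space
begin

lemma prob_vimage_eq_if_same_law:
  assumes "centred_normal X v" "centred_normal Y v" and [measurable]: "B \<in> sets borel"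
  shows "prob {\<omega> \<in> space M. X \<omega> \<in> B} = prob {\<omega> \<in> space M. Y \<omega> \<in> B}"
proof -
  note [measurable] = centred_normalD(1)[OF assms(1)] centred_normalD(1)[OF assms(2)]
  have "measure (distr M borel X) B = measure (distr M borel Y) B"
    using centred_normal_law_unique[OF assms(1,2)] by simp
  then show ?thesis
    by (simp add: measure_distr vimage_def Int_def conj_commute)
qed

end

text \<open>
  The discrete model left after integrating the equation between branching times: one normal variable for
  each particle and each unit of time.
\<close>
locale binary_noise = prob_space M for M :: "'a measure" +
  fixes c v :: real and \<xi> :: "nat \<Rightarrow> nat \<Rightarrow> 'a \<Rightarrow> real"
  assumes \<xi>_indep: "indep_vars (\<lambda>_. borel) (\<lambda>(k, l). \<xi> k l) (SIGMA k:UNIV. {1..2 ^ k})"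
    and \<xi>_normal: "l \<in> {1..2 ^ k} \<Longrightarrow> centred_normal (\<xi> k l) v"
    and v_pos: "v > 0" and c_pos: "c > 0"
begin

abbreviation position :: "(nat \<Rightarrow> nat \<Rightarrow> nat) \<Rightarrow> nat \<Rightarrow> nat \<Rightarrow> 'a \<Rightarrow> real" where
  "position g m i \<omega> \<equiv> rel_pos c g (\<lambda>k l. \<xi> k l \<omega>) m i"

definition levels :: "nat \<Rightarrow> (nat \<times> nat) set" where
  "levels m = (SIGMA k:{..<m}. {1..2 ^ k})"

lemma sum_levels: "(\<Sum>(k, l)\<in>levels m. f k l) = (\<Sum>k<m. \<Sum>l = 1..2 ^ k. f k l :: real)"
  unfolding levels_def by (rule sum.Sigma[symmetric]) auto

lemma finite_levels: "finite (levels m)"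
  by (auto simp: levels_def)

lemma indep_levels: "indep_vars (\<lambda>_. borel) (\<lambda>(k, l). \<xi> k l) (levels m)"
  by (rule indep_vars_subset[OF \<xi>_indep]) (auto simp: levels_def)

lemma position_eq:
  assumes "binary_genealogy g m" "i \<in> {1..2 ^ m}"
  shows "position g m i \<omega> = (\<Sum>p\<in>levels m. (case p of (k, l) \<Rightarrow> rel_coeff c g m i k l) * (case p of (k, l) \<Rightarrow> \<xi> k l) \<omega>)"
  unfolding rel_pos_eq_sum[OF assms] sum_levels[symmetric] by (intro sum.cong) auto

lemma sum_coeff_product:
  assumes "binary_genealogy g m" "i \<in> {1..2 ^ m}" "j \<in> {1..2 ^ m}"
  shows "(\<Sum>p\<in>levels m. (case p of (k, l) \<Rightarrow> rel_coeff c g m i k l) * (case p of (k, l) \<Rightarrow> rel_coeff c g m j k l))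
     = rel_cov c g m i j"
  unfolding rel_cov_eq_sum[OF assms, symmetric] sum_levels[symmetric] by (intro sum.cong) auto

lemma position_normal:
  assumes "binary_genealogy g m" "i \<in> {1..2 ^ m}"
  shows "centred_normal (position g m i) (rel_var c m * v)"
proof -
  have "centred_normal (\<lambda>\<omega>. \<Sum>p\<in>levels m. (case p of (k, l) \<Rightarrow> rel_coeff c g m i k l) * (case p of (k, l) \<Rightarrow> \<xi> k l) \<omega>)
      (\<Sum>p\<in>levels m. (case p of (k, l) \<Rightarrow> rel_coeff c g m i k l)\<^sup>2 * v)"
    by (rule centred_normal_sum[OF indep_levels finite_levels]) (auto simp: levels_def intro!: \<xi>_normal)
  then show ?thesis
    using sum_coeff_product[OF assms assms(2)]
    by (simp add: position_eq[OF assms] sum_distrib_right[symmetric] power2_eq_square rel_cov_self)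
qed

text \<open>
  The scaled noise serves as a reference variable with the law that all relative positions at
  level \<open>m\<close> share; it also covers the levels 0 and 1, where that law is degenerate.
\<close>
definition position_prob :: "real set \<Rightarrow> nat \<Rightarrow> real" where
  "position_prob B m = prob {\<omega> \<in> space M. sqrt (rel_var c m) * \<xi> 0 1 \<omega> \<in> B}"

lemma prob_position:
  assumes "binary_genealogy g m" "i \<in> {1..2 ^ m}" "B \<in> sets borel"
  shows "prob {\<omega> \<in> space M. position g m i \<omega> \<in> B} = position_prob B m"
proof -
  have "centred_normal (\<lambda>\<omega>. sqrt (rel_var c m) * \<xi> 0 1 \<omega>) (rel_var c m * v)"
    using centred_normal_scale[OF \<xi>_normal[of 1 0], of "sqrt (rel_var c m)"] by (simp add: rel_var_nonneg)
  with assms show ?thesis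
    unfolding position_prob_def by (intro prob_vimage_eq_if_same_law[OF position_normal]) auto
qed

definition empirical_error :: "real set \<Rightarrow> nat \<Rightarrow> (nat \<Rightarrow> real) \<Rightarrow> real" where
  "empirical_error B m y = (1 / 2 ^ m) * (\<Sum>i = 1..2 ^ m. indicator B (y i)) - position_prob B m"

text \<open>
  Expanding the square gives the average over pairs of covariances of indicators. The variance of
  a relative position, in units of \<open>v\<close>, is at least \<open>1 / 2\<close> from level 2
  on, which turns the factor 4 into 8.
\<close>
lemma empirical_error_second_moment:
  assumes g: "binary_genealogy g m" and m: "m \<ge> 2" and B[measurable]: "B \<in> sets borel"
  shows "expectation (\<lambda>\<omega>. (empirical_error B m (\<lambda>i. position g m i \<omega>))\<^sup>2) \<le> 8 * cov_bound c m"
proof -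
  let ?N = "2 ^ m :: real" and ?I = "{1..2 ^ m} :: nat set" and ?p = "position_prob B m"
  define u where "u i \<omega> = indicator B (position g m i \<omega>) - ?p" for i \<omega>
  have pos_meas[measurable]: "random_variable borel (position g m i)" if "i \<in> ?I" for i
    using centred_normalD(1)[OF position_normal[OF g that]] .
  have p01: "0 \<le> ?p" "?p \<le> 1" by (auto simp: position_prob_def)
  have u_meas[measurable]: "random_variable borel (u i)" if "i \<in> ?I" for i
    unfolding u_def using that by measurable
  have u_bound: "\<bar>u i \<omega>\<bar> \<le> 1" for i \<omega> using p01 by (auto simp: u_def indicator_def)
  have uu_int: "integrable M (\<lambda>\<omega>. u i \<omega> * u j \<omega>)" if "i \<in> ?I" "j \<in> ?I" for i j
  proof (rule integrable_const_bound[of _ 1])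
    show "AE \<omega> in M. norm (u i \<omega> * u j \<omega>) \<le> 1"
      using mult_mono[OF u_bound u_bound] by (auto simp: abs_mult)
  qed (use that in measurable)
  have var: "rel_var c m \<ge> 1 / 2" by (rule rel_var_ge_half[OF m])
  have cov: "expectation (\<lambda>\<omega>. u i \<omega> * u j \<omega>) \<le> 8 * \<bar>rel_cov c g m i j\<bar>" if i: "i \<in> ?I" and j: "j \<in> ?I" for i j
  proof -
    let ?P = "prob {\<omega> \<in> space M. position g m i \<omega> \<in> B \<and> position g m j \<omega> \<in> B}"
    have ind_int: "integrable M (\<lambda>\<omega>. indicat_real B (position g m k \<omega>))" if "k \<in> ?I" for k
      using that by (intro integrable_const_bound[of _ 1]) (auto simp: indicator_def)
    have ind2_int: "integrable M (\<lambda>\<omega>. indicat_real B (position g m i \<omega>) * indicat_real B (position g m j \<omega>))"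
      using i j by (intro integrable_const_bound[of _ 1]) (auto simp: indicator_def)
    have joint: "expectation (\<lambda>\<omega>. indicat_real B (position g m i \<omega>) * indicat_real B (position g m j \<omega>)) = ?P"
    proof -
      have "expectation (\<lambda>\<omega>. indicat_real B (position g m i \<omega>) * indicat_real B (position g m j \<omega>))
        = expectation (indicat_real {\<omega> \<in> space M. position g m i \<omega> \<in> B \<and> position g m j \<omega> \<in> B})"
        by (intro Bochner_Integration.integral_cong) (auto simp: indicator_def)
      also have "\<dots> = ?P"
        by (subst Bochner_Integration.integral_indicator) (auto intro!: arg_cong[where f = prob])
      finally show ?thesis .
    qed
    have marg: "expectation (\<lambda>\<omega>. indicat_real B (position g m k \<omega>)) = ?p" if k: "k \<in> ?I" for k
      using expectation_indicator_vimage[OF pos_meas[OF k] B] prob_position[OF g k B] by simp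
    have "expectation (\<lambda>\<omega>. u i \<omega> * u j \<omega>) = expectation (\<lambda>\<omega>.
        indicat_real B (position g m i \<omega>) * indicat_real B (position g m j \<omega>)
        - ?p * indicat_real B (position g m i \<omega>) - ?p * indicat_real B (position g m j \<omega>) + ?p * ?p)"
      by (intro Bochner_Integration.integral_cong refl) (simp add: u_def algebra_simps)
    also have "\<dots> = ?P - ?p * ?p"
      using ind_int[OF i] ind_int[OF j] ind2_int by (simp add: joint marg[OF i] marg[OF j] prob_space)
    also have "\<dots> \<le> \<bar>?P - ?p * ?p\<bar>" by simp
    also have "\<bar>?P - ?p * ?p\<bar> \<le> 4 * \<bar>rel_cov c g m i j\<bar> / rel_var c m"
    proof -
      have "\<bar>?P - prob {\<omega> \<in> space M. position g m i \<omega> \<in> B} * prob {\<omega> \<in> space M. position g m j \<omega> \<in> B}\<bar>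
        \<le> 4 * \<bar>\<Sum>p\<in>levels m. (case p of (k, l) \<Rightarrow> rel_coeff c g m i k l) * (case p of (k, l) \<Rightarrow> rel_coeff c g m j k l)\<bar> / rel_var c m"
        unfolding position_eq[OF g i] position_eq[OF g j]
      proof (rule indicator_cov_linear_combinations_le[OF indep_levels finite_levels _ v_pos _ _ _ B])
        show "centred_normal (case p of (k, l) \<Rightarrow> \<xi> k l) v" if "p \<in> levels m" for p
          using that by (auto simp: levels_def intro!: \<xi>_normal)
      qed (use sum_coeff_product[OF g i i] sum_coeff_product[OF g j j] var in \<open>auto simp: power2_eq_square rel_cov_self\<close>)
      then show ?thesis
        unfolding prob_position[OF g i B] prob_position[OF g j B] sum_coeff_product[OF g i j] .
    qed
    also have "\<dots> \<le> 4 * \<bar>rel_cov c g m i j\<bar> / (1 / 2)"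
      using var by (intro divide_left_mono) auto
    finally show ?thesis by simp
  qed
  have "empirical_error B m (\<lambda>i. position g m i \<omega>) = (1 / ?N) * (\<Sum>i\<in>?I. u i \<omega>)" for \<omega>
    by (simp add: empirical_error_def u_def sum_subtractf right_diff_distrib)
  then have "expectation (\<lambda>\<omega>. (empirical_error B m (\<lambda>i. position g m i \<omega>))\<^sup>2)
      = expectation (\<lambda>\<omega>. (1 / 4 ^ m) * (\<Sum>i\<in>?I. \<Sum>j\<in>?I. u i \<omega> * u j \<omega>))"
    by (simp add: power2_eq_square sum_product power_mult_distrib[symmetric])
  also have "\<dots> = (1 / 4 ^ m) * (\<Sum>i\<in>?I. \<Sum>j\<in>?I. expectation (\<lambda>\<omega>. u i \<omega> * u j \<omega>))"
    
  proof -
    have "expectation (\<lambda>\<omega>. \<Sum>i\<in>?I. \<Sum>j\<in>?I. u i \<omega> * u j \<omega>) = (\<Sum>i\<in>?I. expectation (\<lambda>\<omega>. \<Sum>j\<in>?I. u i \<omega> * u j \<omega>))"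
      by (intro Bochner_Integration.integral_sum Bochner_Integration.integrable_sum uu_int)
    also have "\<dots> = (\<Sum>i\<in>?I. \<Sum>j\<in>?I. expectation (\<lambda>\<omega>. u i \<omega> * u j \<omega>))"
      by (intro sum.cong refl Bochner_Integration.integral_sum uu_int)
    finally show ?thesis by simp
  qed
  also have "\<dots> \<le> (1 / 4 ^ m) * (\<Sum>i\<in>?I. \<Sum>j\<in>?I. 8 * \<bar>rel_cov c g m i j\<bar>)"
    by (intro mult_left_mono sum_mono cov) auto
  also have "\<dots> = 8 * ((1 / 4 ^ m) * (\<Sum>i\<in>?I. \<Sum>j\<in>?I. \<bar>rel_cov c g m i j\<bar>))"
    by (simp add: sum_distrib_left)
  also have "\<dots> \<le> 8 * cov_bound c m"
    using mean_abs_rel_cov_le[OF g, of c] by simp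
  finally show ?thesis .
qed

end

section \<open>Two general facts on expectations and almost sure convergence\<close>

lemma (in prob_space) expectation_indep_event:
  fixes h :: "'a \<Rightarrow> real"
  assumes ind: "indep_set (sets P) (sets Q)" and sp: "space P = space M" "space Q = space M"
    and E: "E \<in> sets P" and h: "h \<in> borel_measurable Q" and bound: "\<And>\<omega>. \<bar>h \<omega>\<bar> \<le> K"
  shows "expectation (\<lambda>\<omega>. indicator E \<omega> * h \<omega>) = prob E * expectation h"
proof -
  have PQ: "sets P \<subseteq> events" "sets Q \<subseteq> events" using ind by (auto simp: indep_sets2_eq)
  have [measurable]: "E \<in> events" using E PQ by auto
  have hM[measurable]: "random_variable borel h"
    using h PQ(2) sp(2) by (auto simp: measurable_def)
  have indE: "indicat_real E \<in> borel_measurable P" using E by simp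
  have "indep_var borel (indicat_real E) borel h"
    unfolding indep_var_eq
  proof (intro conjI)
    have "sigma_sets (space M) {indicat_real E -` A \<inter> space M |A. A \<in> sets borel} \<subseteq> sets P"
      unfolding sp(1)[symmetric] using measurable_sets[OF indE] by (intro sets.sigma_sets_subset) auto
    moreover have "sigma_sets (space M) {h -` A \<inter> space M |A. A \<in> sets borel} \<subseteq> sets Q"
      unfolding sp(2)[symmetric] using measurable_sets[OF h] by (intro sets.sigma_sets_subset) auto
    ultimately show "indep_set (sigma_sets (space M) {indicat_real E -` A \<inter> space M |A. A \<in> sets borel})
       (sigma_sets (space M) {h -` A \<inter> space M |A. A \<in> sets borel})"
      using ind unfolding indep_sets2_eq by blast
  qed auto
  then have "expectation (\<lambda>\<omega>. indicat_real E \<omega> * h \<omega>) = expectation (indicat_real E) * expectation h"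
  proof (rule indep_var_lebesgue_integral)
    show "integrable M (indicat_real E)" by (rule integrable_const_bound[of _ 1]) auto
    show "integrable M h" using bound by (intro integrable_const_bound[of _ K]) auto
  qed
  also have "expectation (indicat_real E) = prob E"
    by (subst Bochner_Integration.integral_indicator) (auto intro!: arg_cong[where f = prob])
  finally show ?thesis .
qed

text \<open>
  By monotone convergence the sum of the squares has finite expectation, so it is almost surely
  finite.
\<close>
lemma (in prob_space) AE_tendsto_zero_if_summable_second_moments:
  fixes D :: "nat \<Rightarrow> 'a \<Rightarrow> real"
  assumes D[measurable]: "\<And>m. random_variable borel (D m)" and bound: "\<And>m \<omega>. \<bar>D m \<omega>\<bar> \<le> K"
    and le: "\<And>m. expectation (\<lambda>\<omega>. (D m \<omega>)\<^sup>2) \<le> \<kappa> m" and sum: "summable \<kappa>"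
  shows "AE \<omega> in M. (\<lambda>m. D m \<omega>) \<longlonglongrightarrow> 0"
proof -
  have int: "integrable M (\<lambda>\<omega>. (D m \<omega>)\<^sup>2)" for m
    using bound by (intro integrable_const_bound[of _ "K\<^sup>2"]) (auto intro!: abs_le_square_iff[THEN iffD1] order_trans[OF _ abs_ge_self])
  have \<kappa>: "\<kappa> m \<ge> 0" for m
    by (rule order_trans[OF _ le]) (auto intro!: integral_nonneg_AE)
  have "(\<integral>\<^sup>+ \<omega>. (\<Sum>m. ennreal ((D m \<omega>)\<^sup>2)) \<partial>M) = (\<Sum>m. \<integral>\<^sup>+ \<omega>. ennreal ((D m \<omega>)\<^sup>2) \<partial>M)"
    by (rule nn_integral_suminf) measurable
  also have "\<dots> \<le> (\<Sum>m. ennreal (\<kappa> m))"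
    using le int by (intro suminf_le summableI) (auto simp: nn_integral_eq_integral ennreal_leI)
  also have "\<dots> < \<infinity>"
    using suminf_ennreal_eq[OF \<kappa> sum[THEN summable_sums]] by simp
  finally have "(\<integral>\<^sup>+ \<omega>. (\<Sum>m. ennreal ((D m \<omega>)\<^sup>2)) \<partial>M) \<noteq> \<infinity>" by simp
  then have "AE \<omega> in M. (\<Sum>m. ennreal ((D m \<omega>)\<^sup>2)) \<noteq> \<infinity>"
    by (intro nn_integral_PInf_AE) measurable
  then show ?thesis
  proof eventually_elim
    case (elim \<omega>)
    then have "summable (\<lambda>m. (D m \<omega>)\<^sup>2)"
      by (intro summable_suminf_not_top) auto
    then have "(\<lambda>m. (D m \<omega>)\<^sup>2) \<longlonglongrightarrow> 0" by (rule summable_LIMSEQ_zero)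
    from tendsto_real_sqrt[OF this] show ?case by (simp add: tendsto_rabs_zero_iff)
  qed
qed

section \<open>The Gaussian noise driving the relative system\<close>

context interacting_branching_diffusion
begin

abbreviation rate :: real where "rate \<equiv> \<gamma> + b"

text \<open>
  The stochastic integral of \<open>exp (- rate * (m + 1 - s))\<close> against \<open>W m
  i\<close>, as a pathwise limit. Taking \<open>lim\<close> of the sums makes it a measurable
  function of the path alone, to which the independence hypotheses transfer.
\<close>
definition noise :: "nat \<Rightarrow> nat \<Rightarrow> 'a \<Rightarrow> real" where
  "noise m i \<omega> = lim (\<lambda>n. ou_sum rate (real m) n (\<lambda>t. W m i t \<omega>))"

definition noise_variance :: real where
  "noise_variance = (1 - exp (- 2 * rate)) / (2 * rate)"

lemma grid_in_interval:
  assumes "j \<le> n"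
  shows "a + real j / real (Suc n) \<in> {a..<a + 1}"
  using assms by (auto simp: divide_less_eq)

lemma borel_measurable_ou_limit:
  fixes X :: "real \<Rightarrow> 'b \<Rightarrow> real"
  assumes "\<And>t. t \<in> {a..<a + 1} \<Longrightarrow> X t \<in> borel_measurable N"
  shows "(\<lambda>\<omega>. lim (\<lambda>n. ou_sum r a n (\<lambda>t. X t \<omega>))) \<in> borel_measurable N"
proof (rule borel_measurable_lim_metric)
  fix n
  show "(\<lambda>\<omega>. ou_sum r a n (\<lambda>t. X t \<omega>)) \<in> borel_measurable N"
    unfolding ou_sum_def
    by (intro borel_measurable_sum borel_measurable_times borel_measurable_diff borel_measurable_const assms grid_in_interval) auto
qed

lemma noise_indep: "indep_vars (\<lambda>_. borel) (\<lambda>(m, i). noise m i) (SIGMA m:UNIV. {1..2 ^ m})"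
proof -
  define Y :: "nat \<times> nat \<Rightarrow> (real \<Rightarrow> real) \<Rightarrow> real"
    where "Y = (\<lambda>(m, i) f. lim (\<lambda>n. ou_sum rate (real m) n f))"
  have "indep_vars (\<lambda>_. borel)
      (\<lambda>p \<omega>. Y p ((case p of (m, i) \<Rightarrow> \<lambda>\<omega>. \<lambda>t\<in>{real m..<real m + 1}. W m i t \<omega>) \<omega>)) (SIGMA m:UNIV. {1..2 ^ m})"
  proof (rule indep_vars_compose2[OF W_indep])
    fix p :: "nat \<times> nat" assume "p \<in> (SIGMA m:UNIV. {1..2 ^ m})"
    have "(\<lambda>f. lim (\<lambda>n. ou_sum rate (real m) n (\<lambda>t. f t))) \<in> borel_measurable (Pi\<^sub>M {real m..<real m + 1} (\<lambda>_. borel))" for m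
      by (rule borel_measurable_ou_limit) (rule measurable_component_singleton)
    then show "Y p \<in> measurable (case p of (m, i) \<Rightarrow> Pi\<^sub>M {real m..<real m + 1} (\<lambda>_. borel)) borel"
      by (auto simp: Y_def split: prod.split)
  qed
  also have "?this \<longleftrightarrow> ?thesis"
  proof (rule indep_vars_cong)
    fix p :: "nat \<times> nat"
    obtain m i where p: "p = (m, i)" by force
    have "ou_sum rate (real m) n (\<lambda>t\<in>{real m..<real m + 1}. W m i t \<omega>) = ou_sum rate (real m) n (\<lambda>t. W m i t \<omega>)" for n \<omega>
      by (rule ou_sum_cong) simp
    then show "(\<lambda>\<omega>. Y p ((case p of (m, i) \<Rightarrow> \<lambda>\<omega>. \<lambda>t\<in>{real m..<real m + 1}. W m i t \<omega>) \<omega>)) = (case p of (m, i) \<Rightarrow> noise m i)"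
      by (auto simp: p Y_def noise_def)
  qed auto
  finally show ?thesis .
qed

text \<open>
  The weights of the variance are the squared weights of the sum, so the variance is again a sum
  of the same kind, with twice the rate and the identity in place of the path.
\<close>
lemma W_sum_normal:
  assumes "i \<in> {1..2 ^ m}"
  shows "centred_normal (\<lambda>\<omega>. ou_sum rate (real m) n (\<lambda>t. W m i t \<omega>)) (ou_sum (2 * rate) (real m) n (\<lambda>t. t))"
proof -
  define \<tau> where "\<tau> j = real m + real j / real (Suc n)" for j
  have bm: "brownian_motion_on (real m) (real m + 1) (W m i)" by (rule W_brownian[OF assms])
  have \<tau>: "\<tau> j \<in> {real m..<real m + 1}" if "j \<le> n" for j
    unfolding \<tau>_def by (rule grid_in_interval[OF that])
  have \<tau>_less: "\<tau> j < \<tau> k" if "j < k" for j k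
    using that by (simp add: \<tau>_def divide_strict_right_mono)
  have ind: "indep_vars (\<lambda>_. borel) (\<lambda>k \<omega>. W m i (\<tau> (Suc k)) \<omega> - W m i (\<tau> k) \<omega>) {..<n}"
    using bm \<tau> \<tau>_less unfolding brownian_motion_on_def by (auto simp: strict_mono_on_def image_subset_iff)
  have "centred_normal (\<lambda>\<omega>. W m i (\<tau> (Suc k)) \<omega> - W m i (\<tau> k) \<omega>) (\<tau> (Suc k) - \<tau> k)" if "k < n" for k
  proof -
    have "distributed M lborel (\<lambda>\<omega>. W m i (\<tau> (Suc k)) \<omega> - W m i (\<tau> k) \<omega>) (normal_density 0 (sqrt (\<tau> (Suc k) - \<tau> k)))"
      using bm \<tau>[of k] \<tau>[of "Suc k"] \<tau>_less[of k "Suc k"] that unfolding brownian_motion_on_def by auto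
    from centred_normal_if_distributed[OF this] show ?thesis
      using \<tau>_less[of k "Suc k"] by simp
  qed
  from centred_normal_sum[OF ind _ this, of "\<lambda>j. exp (- rate * (1 - real (Suc j) / real (Suc n)))"]
  have "centred_normal (\<lambda>\<omega>. ou_sum rate (real m) n (\<lambda>t. W m i t \<omega>))
     (\<Sum>j<n. (exp (- rate * (1 - real (Suc j) / real (Suc n))))\<^sup>2 * (\<tau> (Suc j) - \<tau> j))"
    by (simp add: ou_sum_def \<tau>_def)
  also have "(\<Sum>j<n. (exp (- rate * (1 - real (Suc j) / real (Suc n))))\<^sup>2 * (\<tau> (Suc j) - \<tau> j))
      = ou_sum (2 * rate) (real m) n (\<lambda>t. t)"
    unfolding ou_sum_def \<tau>_def
    by (intro sum.cong refl arg_cong2[where f = "(*)"]) (simp only: exp_double[symmetric], simp)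
  finally show ?thesis .
qed

context
  assumes rate_pos: "rate > 0"
begin

lemma noise_variance_pos: "noise_variance > 0"
  using rate_pos by (auto simp: noise_variance_def intro!: divide_pos_pos)

text \<open>
  The identity is the forcing that keeps the constant \<open>1 / (2 * rate)\<close> a solution of
  the equation of rate \<open>2 * rate\<close>.
\<close>
lemma noise_variance_limit: "(\<lambda>n. ou_sum (2 * rate) a n (\<lambda>t. t)) \<longlonglongrightarrow> noise_variance"
proof -
  have "(\<lambda>n. ou_sum (2 * rate) a n (\<lambda>t. t)) \<longlonglongrightarrow> 1 / (2 * rate) - exp (- (2 * rate)) * (1 / (2 * rate))"
  proof (rule ou_sum_tendsto_solution[where y = "\<lambda>_. 1 / (2 * rate)" and k = "a - 1 / (2 * rate)"])
    fix t assume "t \<in> {a..<a + 1}"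
    then show "t = 1 / (2 * rate) + 2 * rate * integral {a..t} (\<lambda>_. 1 / (2 * rate)) + (a - 1 / (2 * rate))"
      using rate_pos by simp
  qed (use rate_pos in auto)
  then show ?thesis by (simp add: noise_variance_def diff_divide_distrib)
qed

text \<open>
  Every particle has a child, and the child starts at the left limit of its parent; so all left
  limits at branching times exist. Since every particle has exactly two children, the center of
  mass does not jump.
\<close>
lemma relative_system_recursion:
  "AE \<omega> in M. (\<forall>m. \<forall>i\<in>{1..2 ^ m}. (\<lambda>n. ou_sum rate (real m) n (\<lambda>t. W m i t \<omega>)) \<longlonglongrightarrow> noise m i \<omega>) \<and>
     (\<forall>m. \<forall>j\<in>{1..2 ^ Suc m}. relative_system Z (real (Suc m)) j \<omega> =
        exp (- rate) * relative_system Z (real m) (par m j \<omega>) \<omega> + noise m (par m j \<omega>) \<omega>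
        - (1 / 2 ^ m) * (\<Sum>l = 1..2 ^ m. noise m l \<omega>))"
  using par_two_offspring Z_continuous Z_sde Z_branching
proof eventually_elim
  case (elim \<omega>)
  have par: "par m j \<omega> \<in> {1..2 ^ m}" if "j \<in> {1..2 ^ Suc m}" for m j using elim(1) that by blast
  have two: "card {j \<in> {1..2 ^ Suc m}. par m j \<omega> = i} = 2" if "i \<in> {1..2 ^ m}" for m i using elim(1) that by blast
  define child where "child m i = (SOME j. j \<in> {1..2 ^ Suc m} \<and> par m j \<omega> = i)" for m i
  have child: "child m i \<in> {1..2 ^ Suc m}" "par m (child m i) \<omega> = i" if "i \<in> {1..2 ^ m}" for m i
  proof -
    have "{j \<in> {1..2 ^ Suc m}. par m j \<omega> = i} \<noteq> {}" using two[OF that] by (metis card.empty zero_neq_numeral)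
    then have "\<exists>j. j \<in> {1..2 ^ Suc m} \<and> par m j \<omega> = i" by blast
    from someI_ex[OF this] show "child m i \<in> {1..2 ^ Suc m}" "par m (child m i) \<omega> = i"
      unfolding child_def by blast+
  qed
  define L where "L m i = Z (real (Suc m)) (child m i) \<omega>" for m i
  have L_lim: "((\<lambda>t. Z t i \<omega>) \<longlongrightarrow> L m i) (at_left (real m + 1))" if "i \<in> {1..2 ^ m}" for m i
    using elim(4)[rule_format, OF child(1)[OF that]] child(2)[OF that] by (simp add: L_def add.commute)
  have Z_L: "Z (real (Suc m)) j \<omega> = L m (par m j \<omega>)" if "j \<in> {1..2 ^ Suc m}" for m j
  proof (rule tendsto_unique[OF trivial_limit_at_left_real])
    show "((\<lambda>t. Z t (par m j \<omega>) \<omega>) \<longlongrightarrow> Z (real (Suc m)) j \<omega>) (at_left (real m + 1))"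
      using elim(4)[rule_format, OF that] by (simp add: add.commute)
    show "((\<lambda>t. Z t (par m j \<omega>) \<omega>) \<longlongrightarrow> L m (par m j \<omega>)) (at_left (real m + 1))"
      by (rule L_lim[OF par[OF that]])
  qed
  have motion: "(\<lambda>n. ou_sum rate (real m) n (\<lambda>t. W m i t \<omega>)) \<longlonglongrightarrow> noise m i \<omega>"
      "L m i - (1 / 2 ^ m) * (\<Sum>j = 1..2 ^ m. L m j)
       = exp (- rate) * (Z (real m) i \<omega> - (1 / 2 ^ m) * (\<Sum>j = 1..2 ^ m. Z (real m) j \<omega>))
         + noise m i \<omega> - (1 / 2 ^ m) * (\<Sum>j = 1..2 ^ m. noise m j \<omega>)"
    if i: "i \<in> {1..2 ^ m}" for m i
    unfolding noise_def
    by (rule relative_motion_over_unit_interval[where I = "{1..2 ^ m}" and a = "real m" and r = "1 / 2 ^ m"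
          and z = "\<lambda>i t. Z t i \<omega>" and w = "\<lambda>i t. W m i t \<omega>" and L = "L m"];
        use i elim(2,3) L_lim rate_pos in auto)+
  have mean: "(\<Sum>j = 1..2 ^ Suc m. Z (real (Suc m)) j \<omega>) = 2 * (\<Sum>i = 1..2 ^ m. L m i)" for m
  proof -
    have "(\<Sum>j = 1..2 ^ Suc m. Z (real (Suc m)) j \<omega>) = (\<Sum>j = 1..2 ^ Suc m. L m (par m j \<omega>))"
      by (intro sum.cong refl Z_L)
    also have "\<dots> = 2 * (\<Sum>i = 1..2 ^ m. L m i)"
      by (rule sum_over_offspring[OF par two])
    finally show ?thesis .
  qed
  have rel: "relative_system Z (real m) i \<omega> = Z (real m) i \<omega> - (1 / 2 ^ m) * (\<Sum>j = 1..2 ^ m. Z (real m) j \<omega>)" for m i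
    by (simp add: relative_system_def center_of_mass_def)
  have "relative_system Z (real (Suc m)) j \<omega> = L m (par m j \<omega>) - (1 / 2 ^ m) * (\<Sum>i = 1..2 ^ m. L m i)"
    if "j \<in> {1..2 ^ Suc m}" for m j
    unfolding rel mean Z_L[OF that] by simp
  then show ?case
    using motion par unfolding rel[of _ "par _ _ _"] by simp
qed

lemma relative_system_eq_rel_pos:
  "AE \<omega> in M. \<forall>m. \<forall>i\<in>{1..2 ^ m}. relative_system Z (real m) i \<omega>
     = rel_pos rate (\<lambda>k j. par k j \<omega>) (\<lambda>k l. noise k l \<omega>) m i"
  using relative_system_recursion par_two_offspring
proof eventually_elim
  case (elim \<omega>)
  have "\<forall>i\<in>{1..2 ^ m}. relative_system Z (real m) i \<omega>
     = rel_pos rate (\<lambda>k j. par k j \<omega>) (\<lambda>k l. noise k l \<omega>) m i" for m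
  proof (induction m)
    case 0
    show ?case by (simp add: relative_system_def center_of_mass_def)
  next
    case (Suc m)
    show ?case
    proof
      fix j :: nat assume j: "j \<in> {1..2 ^ Suc m}"
      then have "par m j \<omega> \<in> {1..2 ^ m}" using elim(2) by blast
      with Suc.IH elim(1) j show "relative_system Z (real (Suc m)) j \<omega>
          = rel_pos rate (\<lambda>k j. par k j \<omega>) (\<lambda>k l. noise k l \<omega>) (Suc m) j"
        by simp
    qed
  qed
  then show ?case by blast
qed

text \<open>
  The almost sure convergence of the sums comes from the equation itself, through
  \<open>relative_system_recursion\<close>.
\<close>
lemma noise_normal:
  assumes "i \<in> {1..2 ^ m}"
  shows "centred_normal (noise m i) noise_variance"
proof (rule centred_normal_limit[OF W_sum_normal[OF assms] noise_variance_limit])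
  show "AE \<omega> in M. (\<lambda>n. ou_sum rate (real m) n (\<lambda>t. W m i t \<omega>)) \<longlonglongrightarrow> noise m i \<omega>"
    using relative_system_recursion by eventually_elim (use assms in blast)
  have "random_variable borel (W m i t)" if "t \<in> {real m..<real m + 1}" for t
    using W_brownian[OF assms] that unfolding brownian_motion_on_def by blast
  then show "random_variable borel (noise m i)"
    unfolding noise_def by (rule borel_measurable_ou_limit)
qed

lemma binary_noise: "binary_noise M rate noise_variance noise"
  by unfold_locales (use noise_indep noise_normal noise_variance_pos rate_pos in auto)

end

section \<open>Averaging over the random genealogy\<close>

definition genealogy_sigma :: "'a measure" where
  "genealogy_sigma = vimage_algebra (space M)
     (\<lambda>\<omega>. \<lambda>(m, j)\<in>(SIGMA m:UNIV. {1..2 ^ Suc m}). par m j \<omega>)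
     (Pi\<^sub>M (SIGMA m:UNIV. {1..2 ^ Suc m}) (\<lambda>_. count_space UNIV))"

definition motion_sigma :: "'a measure" where
  "motion_sigma = vimage_algebra (space M)
     (\<lambda>\<omega>. \<lambda>(m, i, t)\<in>(SIGMA m:UNIV. {1..2 ^ m} \<times> {real m..<real m + 1}). W m i t \<omega>)
     (Pi\<^sub>M (SIGMA m:UNIV. {1..2 ^ m} \<times> {real m..<real m + 1}) (\<lambda>_. borel))"

lemma indep_genealogy_motion: "indep_set (sets genealogy_sigma) (sets motion_sigma)"
  using par_indep by (simp add: genealogy_sigma_def motion_sigma_def)

lemma space_sigma [simp]: "space genealogy_sigma = space M" "space motion_sigma = space M"
  by (simp_all add: genealogy_sigma_def motion_sigma_def)

lemma measurable_par:
  assumes "j \<in> {1..2 ^ Suc m}"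
  shows "par m j \<in> measurable genealogy_sigma (count_space UNIV)"
proof -
  let ?I = "SIGMA m:UNIV. {1..2 ^ Suc m :: nat}"
  have 1: "(\<lambda>\<omega>. \<lambda>(m, j)\<in>?I. par m j \<omega>) \<in> measurable genealogy_sigma (Pi\<^sub>M ?I (\<lambda>_. count_space UNIV))"
    unfolding genealogy_sigma_def by (rule measurable_vimage_algebra1) (auto simp: space_PiM)
  have 2: "(\<lambda>f. f (m, j)) \<in> measurable (Pi\<^sub>M ?I (\<lambda>_. count_space UNIV)) (count_space UNIV)"
    using assms by (intro measurable_component_singleton[where M = "\<lambda>_. count_space UNIV"]) auto
  show ?thesis using measurable_compose[OF 1 2] assms by simp
qed

lemma measurable_W:
  assumes "i \<in> {1..2 ^ m}" "t \<in> {real m..<real m + 1}"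
  shows "W m i t \<in> borel_measurable motion_sigma"
proof -
  let ?I = "SIGMA m:UNIV. {1..2 ^ m :: nat} \<times> {real m..<real m + 1}"
  have 1: "(\<lambda>\<omega>. \<lambda>(m, i, t)\<in>?I. W m i t \<omega>) \<in> measurable motion_sigma (Pi\<^sub>M ?I (\<lambda>_. borel))"
    unfolding motion_sigma_def by (rule measurable_vimage_algebra1) (auto simp: space_PiM)
  have 2: "(\<lambda>f. f (m, i, t)) \<in> measurable (Pi\<^sub>M ?I (\<lambda>_. borel)) borel"
    using assms by (intro measurable_component_singleton[where M = "\<lambda>_. borel"]) auto
  show ?thesis using measurable_compose[OF 1 2] assms by simp
qed

lemma measurable_noise:
  assumes "i \<in> {1..2 ^ m}"
  shows "noise m i \<in> borel_measurable motion_sigma"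
  unfolding noise_def by (rule borel_measurable_ou_limit) (rule measurable_W[OF assms])

text \<open>
  A random genealogy takes finitely many values up to level \<open>m\<close>. On the event that it
  equals \<open>g\<close> the variable \<open>\<Psi>\<close> is \<open>\<Phi> g\<close>, which is
  independent of that event as a functional of the motions; so the expectation of
  \<open>\<Psi>\<close> is a weighted average of those of the \<open>\<Phi> g\<close>.
\<close>
lemma expectation_le_if_le_for_each_genealogy:
  fixes \<Phi> :: "(nat \<Rightarrow> nat \<Rightarrow> nat) \<Rightarrow> 'a \<Rightarrow> real"
  assumes \<Phi>: "\<And>g. binary_genealogy g m \<Longrightarrow> \<Phi> g \<in> borel_measurable motion_sigma"
    and bound: "\<And>g \<omega>. \<bar>\<Phi> g \<omega>\<bar> \<le> K"
    and le: "\<And>g. binary_genealogy g m \<Longrightarrow> expectation (\<Phi> g) \<le> \<kappa>"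
    and \<Psi>[measurable]: "random_variable borel \<Psi>"
    and eq: "AE \<omega> in M. \<forall>g. binary_genealogy g m \<longrightarrow>
        (\<forall>k<m. \<forall>j\<in>{1..2 ^ Suc k}. g k j = par k j \<omega>) \<longrightarrow> \<Psi> \<omega> = \<Phi> g \<omega>"
  shows "expectation \<Psi> \<le> \<kappa>"
proof -
  define J where "J = (SIGMA k:{..<m}. {1..2 ^ Suc k :: nat})"
  define G where "G = {g \<in> PiE J (\<lambda>(k, j). {1..2 ^ k :: nat}). binary_genealogy (curry g) m}"
  define E where "E g = {\<omega> \<in> space M. \<forall>(k, j)\<in>J. par k j \<omega> = g (k, j)}" for g :: "nat \<times> nat \<Rightarrow> nat"
  have finJ: "finite J" by (auto simp: J_def)
  have finG: "finite G"
    unfolding G_def using finJ by (intro finite_Collect_conjI disjI1, subst Collect_mem_eq) (auto intro!: finite_PiE)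
  have E_sigma: "E g \<in> sets genealogy_sigma" for g
  proof -
    have "{\<omega> \<in> space genealogy_sigma. \<forall>p\<in>J. par (fst p) (snd p) \<omega> = g p} \<in> sets genealogy_sigma"
    proof (rule sets.sets_Collect_finite_All[OF _ finJ])
      fix p assume "p \<in> J"
      then have "par (fst p) (snd p) \<in> measurable genealogy_sigma (count_space UNIV)"
        by (intro measurable_par) (auto simp: J_def)
      from measurable_sets[OF this, of "{g p}"]
      show "{\<omega> \<in> space genealogy_sigma. par (fst p) (snd p) \<omega> = g p} \<in> sets genealogy_sigma"
        by (simp add: vimage_def Int_def conj_commute)
    qed
    also have "{\<omega> \<in> space genealogy_sigma. \<forall>p\<in>J. par (fst p) (snd p) \<omega> = g p} = E g"
      by (auto simp: E_def)
    finally show ?thesis .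
  qed
  have ev: "sets genealogy_sigma \<subseteq> events" "sets motion_sigma \<subseteq> events"
    using indep_genealogy_motion by (auto simp: indep_sets2_eq)
  have E_meas[measurable]: "E g \<in> events" for g using E_sigma ev by auto
  have \<Phi>_meas: "random_variable borel (\<Phi> (curry g))" if "g \<in> G" for g
    using \<Phi>[of "curry g"] that ev(2) by (auto simp: G_def measurable_def)
  have unique: "AE \<omega> in M. \<exists>h\<in>G. \<omega> \<in> E h \<and> (\<forall>g\<in>G. \<omega> \<in> E g \<longrightarrow> g = h) \<and> \<Psi> \<omega> = \<Phi> (curry h) \<omega>"
    using par_two_offspring eq AE_space
  proof eventually_elim
    case (elim \<omega>)
    define h where "h = (\<lambda>(k, j)\<in>J. par k j \<omega>)"
    have agree: "curry h k j = par k j \<omega>" if "k < m" "j \<in> {1..2 ^ Suc k}" for k j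
      using that by (simp add: h_def J_def)
    have "binary_genealogy (curry h) m"
      unfolding binary_genealogy_def
    proof (intro allI impI conjI ballI)
      fix k j :: nat assume kj: "k < m" "j \<in> {1..2 ^ Suc k}"
      have "par k j \<omega> \<in> {1..2 ^ k}" using elim(1) kj(2) by blast
      then show "curry h k j \<in> {1..2 ^ k}" unfolding agree[OF kj] .
    next
      fix k i :: nat assume k: "k < m" and i: "i \<in> {1..2 ^ k}"
      have "{j \<in> {1..2 ^ Suc k}. curry h k j = i} = {j \<in> {1..2 ^ Suc k}. par k j \<omega> = i}"
        using agree[OF k] by (intro Collect_cong conj_cong refl) auto
      then show "card {j \<in> {1..2 ^ Suc k}. curry h k j = i} = 2" using elim(1) i by simp
    qed
    moreover have "h \<in> PiE J (\<lambda>(k, j). {1..2 ^ k})"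
    proof (rule PiE_I)
      fix p assume "p \<in> J"
      then obtain k j where p: "p = (k, j)" "k < m" "j \<in> {1..2 ^ Suc k}" unfolding J_def by blast
      have "par k j \<omega> \<in> {1..2 ^ k}" using elim(1) p(3) by blast
      then show "h p \<in> (case p of (k, j) \<Rightarrow> {1..2 ^ k})"
        using \<open>p \<in> J\<close> by (simp add: h_def p(1))
    next
      show "h p = undefined" if "p \<notin> J" for p using that by (simp add: h_def)
    qed
    ultimately have "h \<in> G" by (simp add: G_def)
    moreover have "\<omega> \<in> E h" using elim(3) by (auto simp: E_def h_def)
    moreover have "g = h" if "g \<in> G" "\<omega> \<in> E g" for g
    proof (rule PiE_ext)
      show "g \<in> PiE J (\<lambda>(k, j). {1..2 ^ k})" "h \<in> PiE J (\<lambda>(k, j). {1..2 ^ k})"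
        using that(1) \<open>h \<in> G\<close> by (auto simp: G_def)
      show "g p = h p" if "p \<in> J" for p
        using that \<open>\<omega> \<in> E g\<close> by (auto simp: E_def h_def)
    qed
    moreover have "\<Psi> \<omega> = \<Phi> (curry h) \<omega>"
      using elim(2) agree \<open>h \<in> G\<close> by (auto simp: G_def)
    ultimately show ?case by blast
  qed
  have single: "AE \<omega> in M. (\<Sum>g\<in>G. indicator (E g) \<omega> * f g \<omega>) = f (THE h. h \<in> G \<and> \<omega> \<in> E h) \<omega>
      \<and> \<Psi> \<omega> = \<Phi> (curry (THE h. h \<in> G \<and> \<omega> \<in> E h)) \<omega>" for f :: "(nat \<times> nat \<Rightarrow> nat) \<Rightarrow> 'a \<Rightarrow> real"
    using unique
  proof eventually_elim
    case (elim \<omega>)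
    then obtain h where h: "h \<in> G" "\<omega> \<in> E h" "\<And>g. g \<in> G \<Longrightarrow> \<omega> \<in> E g \<Longrightarrow> g = h" "\<Psi> \<omega> = \<Phi> (curry h) \<omega>" by blast
    have the: "(THE h. h \<in> G \<and> \<omega> \<in> E h) = h"
    proof (rule the_equality)
      show "h \<in> G \<and> \<omega> \<in> E h" using h(1,2) by simp
      show "g = h" if "g \<in> G \<and> \<omega> \<in> E g" for g using h(3)[of g] that by simp
    qed
    have "(\<Sum>g\<in>G. indicator (E g) \<omega> * f g \<omega>) = (\<Sum>g\<in>G. if g = h then f h \<omega> else 0)"
    proof (rule sum.cong[OF refl])
      fix g assume "g \<in> G"
      then have "\<omega> \<in> E g \<longleftrightarrow> g = h" using h(2) h(3)[of g] by blast
      then show "indicator (E g) \<omega> * f g \<omega> = (if g = h then f h \<omega> else 0)"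
        using h(2) by (auto simp: indicator_def)
    qed
    then show ?case using finG h(1,4) by (simp add: the)
  qed
  have int: "integrable M (\<lambda>\<omega>. indicator (E g) \<omega> * \<Phi> (curry g) \<omega>)" if "g \<in> G" for g
    using \<Phi>_meas[OF that] bound[of "curry g"] order_trans[OF abs_ge_zero bound]
    by (intro integrable_const_bound[of _ K]) (auto simp: indicator_def)
  (* The events E g for g in G partition the space up to a null set. *)
  have total: "(\<Sum>g\<in>G. prob (E g)) = 1"
  proof -
    have "(\<Sum>g\<in>G. prob (E g)) = (\<Sum>g\<in>G. expectation (indicat_real (E g)))"
      by (intro sum.cong refl, subst Bochner_Integration.integral_indicator) (auto simp: E_def intro!: arg_cong[where f = prob])
    also have "\<dots> = expectation (\<lambda>\<omega>. \<Sum>g\<in>G. indicat_real (E g) \<omega>)"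
      by (intro Bochner_Integration.integral_sum[symmetric] integrable_const_bound[of _ 1]) auto
    also have "\<dots> = expectation (\<lambda>\<omega>. 1)"
    proof (rule integral_cong_AE)
      show "AE \<omega> in M. (\<Sum>g\<in>G. indicat_real (E g) \<omega>) = 1"
        using single[of "\<lambda>_ _. 1"] by eventually_elim simp
    qed auto
    finally show ?thesis by (simp add: prob_space)
  qed
  have "expectation \<Psi> = expectation (\<lambda>\<omega>. \<Sum>g\<in>G. indicator (E g) \<omega> * \<Phi> (curry g) \<omega>)"
  proof (rule integral_cong_AE)
    show "AE \<omega> in M. \<Psi> \<omega> = (\<Sum>g\<in>G. indicator (E g) \<omega> * \<Phi> (curry g) \<omega>)"
      using single[of "\<lambda>g. \<Phi> (curry g)"] by eventually_elim simp
    show "(\<lambda>\<omega>. \<Sum>g\<in>G. indicator (E g) \<omega> * \<Phi> (curry g) \<omega>) \<in> borel_measurable M"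
      using int by (intro borel_measurable_sum borel_measurable_integrable)
  qed simp
  also have "\<dots> = (\<Sum>g\<in>G. expectation (\<lambda>\<omega>. indicator (E g) \<omega> * \<Phi> (curry g) \<omega>))"
    by (rule Bochner_Integration.integral_sum[OF int])
  also have "\<dots> = (\<Sum>g\<in>G. prob (E g) * expectation (\<Phi> (curry g)))"
    using \<Phi> bound by (intro sum.cong refl expectation_indep_event[OF indep_genealogy_motion _ _ E_sigma]) (auto simp: G_def)
  also have "\<dots> \<le> (\<Sum>g\<in>G. prob (E g) * \<kappa>)"
    using le by (intro sum_mono mult_left_mono) (auto simp: G_def)
  also have "\<dots> = \<kappa>" by (simp add: sum_distrib_right[symmetric] total)
  finally show ?thesis .
qed

section \<open>The strong law for the relative system\<close>

context
  assumes rate_pos: "rate > 0"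
begin

interpretation noise: binary_noise M rate noise_variance noise
  by (rule binary_noise[OF rate_pos])

lemma measurable_position:
  assumes "binary_genealogy g m" "i \<in> {1..2 ^ m}"
  shows "noise.position g m i \<in> borel_measurable motion_sigma"
  unfolding noise.position_eq[OF assms]
  by (intro borel_measurable_sum borel_measurable_times borel_measurable_const)
     (auto simp: noise.levels_def intro!: measurable_noise)

lemma relative_system_eq_position:
  "AE \<omega> in M. \<forall>g. binary_genealogy g m \<longrightarrow> (\<forall>k<m. \<forall>j\<in>{1..2 ^ Suc k}. g k j = par k j \<omega>) \<longrightarrow>
     (\<forall>i\<in>{1..2 ^ m}. relative_system Z (real m) i \<omega> = noise.position g m i \<omega>)"
  using relative_system_eq_rel_pos[OF rate_pos]
proof eventually_elim
  case (elim \<omega>)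
  show ?case
  proof (intro allI impI ballI)
    fix g and i :: nat
    assume "binary_genealogy g m" "\<forall>k<m. \<forall>j\<in>{1..2 ^ Suc k}. g k j = par k j \<omega>" "i \<in> {1..2 ^ m}"
    with elim rel_pos_cong[of g m "\<lambda>k j. par k j \<omega>" i]
    show "relative_system Z (real m) i \<omega> = noise.position g m i \<omega>" by simp
  qed
qed

lemma measurable_relative_system:
  assumes "i \<in> {1..2 ^ m}"
  shows "random_variable borel (relative_system Z (real m) i)"
  unfolding relative_system_def center_of_mass_def
  by (intro borel_measurable_diff borel_measurable_times borel_measurable_const borel_measurable_sum Z_measurable)
     (use assms in auto)

text \<open>
  Averaging over genealogies bounds expectations from above; applied to the indicator and to its
  complement it gives equality.
\<close>
lemma prob_relative_system:
  assumes i: "i \<in> {1..2 ^ m}" and B[measurable]: "B \<in> sets borel"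
  shows "prob {\<omega> \<in> space M. relative_system Z (real m) i \<omega> \<in> B} = noise.position_prob B m"
proof -
  note [measurable] = measurable_relative_system[OF i]
  let ?X = "\<lambda>\<omega>. indicat_real B (relative_system Z (real m) i \<omega>)"
  have eq: "AE \<omega> in M. \<forall>g. binary_genealogy g m \<longrightarrow> (\<forall>k<m. \<forall>j\<in>{1..2 ^ Suc k}. g k j = par k j \<omega>) \<longrightarrow>
     relative_system Z (real m) i \<omega> = noise.position g m i \<omega>"
    using relative_system_eq_position[of m] by eventually_elim (use i in blast)
  have pos: "noise.position g m i \<in> borel_measurable motion_sigma" "noise.position g m i \<in> borel_measurable M"
    "expectation (\<lambda>\<omega>. indicat_real B (noise.position g m i \<omega>)) = noise.position_prob B m"
    if "binary_genealogy g m" for g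
    using measurable_position[OF that i] centred_normalD(1)[OF noise.position_normal[OF that i]]
      expectation_indicator_vimage[OF _ B] noise.prob_position[OF that i B] by auto
  have int: "integrable M (\<lambda>\<omega>. indicat_real B (X \<omega>))" if [measurable]: "random_variable borel X" for X :: "'a \<Rightarrow> real"
    by (rule integrable_const_bound[of _ 1]) (auto simp: indicator_def)
  have "expectation ?X \<le> noise.position_prob B m"
  proof (rule expectation_le_if_le_for_each_genealogy[where m = m and K = 1])
    show "AE \<omega> in M. \<forall>g. binary_genealogy g m \<longrightarrow> (\<forall>k<m. \<forall>j\<in>{1..2 ^ Suc k}. g k j = par k j \<omega>) \<longrightarrow>
        ?X \<omega> = indicat_real B (noise.position g m i \<omega>)"
      using eq by eventually_elim simp
    show "(\<lambda>\<omega>. indicat_real B (noise.position g m i \<omega>)) \<in> borel_measurable motion_sigma" if "binary_genealogy g m" for g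
      using pos(1)[OF that] by measurable
    show "expectation (\<lambda>\<omega>. indicat_real B (noise.position g m i \<omega>)) \<le> noise.position_prob B m"
      if "binary_genealogy g m" for g
      using pos(3)[OF that] by simp
  qed (auto simp: indicator_def)
  moreover have "expectation (\<lambda>\<omega>. 1 - ?X \<omega>) \<le> 1 - noise.position_prob B m"
  proof (rule expectation_le_if_le_for_each_genealogy[where m = m and K = 1])
    show "AE \<omega> in M. \<forall>g. binary_genealogy g m \<longrightarrow> (\<forall>k<m. \<forall>j\<in>{1..2 ^ Suc k}. g k j = par k j \<omega>) \<longrightarrow>
        1 - ?X \<omega> = 1 - indicat_real B (noise.position g m i \<omega>)"
      using eq by eventually_elim simp
    show "(\<lambda>\<omega>. 1 - indicat_real B (noise.position g m i \<omega>)) \<in> borel_measurable motion_sigma" if "binary_genealogy g m" for g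
      using pos(1)[OF that] by measurable
    show "expectation (\<lambda>\<omega>. 1 - indicat_real B (noise.position g m i \<omega>)) \<le> 1 - noise.position_prob B m"
      if "binary_genealogy g m" for g
      using int[OF pos(2)[OF that]] pos(3)[OF that] by (simp add: prob_space)
  qed (auto simp: indicator_def)
  moreover have "expectation (\<lambda>\<omega>. 1 - ?X \<omega>) = 1 - expectation ?X"
    using int[OF measurable_relative_system[OF i]] by (simp add: prob_space)
  ultimately have "expectation ?X = noise.position_prob B m" by linarith
  then show ?thesis
    using expectation_indicator_vimage[OF measurable_relative_system[OF i] B] by simp
qed

lemma empirical_error_bound: "\<bar>noise.empirical_error B m y\<bar> \<le> 1"
proof -
  have "(\<Sum>i = 1..2 ^ m. indicator B (y i)) \<le> (\<Sum>i = 1..2 ^ m :: nat. 1 :: real)"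
    by (intro sum_mono) (auto simp: indicator_def)
  moreover have "(\<Sum>i = 1..2 ^ m. indicator B (y i)) \<ge> (0 :: real)"
    by (intro sum_nonneg) auto
  ultimately have "0 \<le> (1 / 2 ^ m) * (\<Sum>i = 1..2 ^ m. indicat_real B (y i))"
    "(1 / 2 ^ m) * (\<Sum>i = 1..2 ^ m. indicat_real B (y i)) \<le> 1"
    by (auto simp: divide_le_eq)
  moreover have "0 \<le> noise.position_prob B m" "noise.position_prob B m \<le> 1"
    by (auto simp: noise.position_prob_def)
  ultimately show ?thesis unfolding noise.empirical_error_def by linarith
qed

lemma measurable_empirical_error:
  assumes B: "B \<in> sets borel" and X: "\<And>i. i \<in> {1..2 ^ m} \<Longrightarrow> X i \<in> borel_measurable N"
  shows "(\<lambda>\<omega>. noise.empirical_error B m (\<lambda>i. X i \<omega>)) \<in> borel_measurable N"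
  unfolding noise.empirical_error_def
  by (intro borel_measurable_diff borel_measurable_times borel_measurable_const borel_measurable_sum)
     (rule measurable_compose[OF X borel_measurable_indicator[OF B]])

text \<open>
  The bound on the second moment holds from level 2 on, so the first two terms are dropped.
\<close>
lemma empirical_distribution_converges:
  assumes B: "B \<in> sets borel"
  shows "AE \<omega> in M. (\<lambda>m. noise.empirical_error B m (\<lambda>i. relative_system Z (real m) i \<omega>)) \<longlonglongrightarrow> 0"
proof -
  let ?D = "\<lambda>m \<omega>. noise.empirical_error B m (\<lambda>i. relative_system Z (real m) i \<omega>)"
  have D_meas: "random_variable borel (?D m)" for m
    by (rule measurable_empirical_error[OF B measurable_relative_system])
  have moment: "expectation (\<lambda>\<omega>. (?D m \<omega>)\<^sup>2) \<le> 8 * cov_bound rate m" if m: "m \<ge> 2" for m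
  proof (rule expectation_le_if_le_for_each_genealogy[where m = m and K = 1])
    show "AE \<omega> in M. \<forall>g. binary_genealogy g m \<longrightarrow> (\<forall>k<m. \<forall>j\<in>{1..2 ^ Suc k}. g k j = par k j \<omega>) \<longrightarrow>
        (?D m \<omega>)\<^sup>2 = (noise.empirical_error B m (\<lambda>i. noise.position g m i \<omega>))\<^sup>2"
      using relative_system_eq_position[of m]
    proof eventually_elim
      case (elim \<omega>)
      then show ?case by (auto simp: noise.empirical_error_def intro!: sum.cong)
    qed
    show "(\<lambda>\<omega>. (noise.empirical_error B m (\<lambda>i. noise.position g m i \<omega>))\<^sup>2) \<in> borel_measurable motion_sigma"
      if "binary_genealogy g m" for g
      by (intro borel_measurable_power measurable_empirical_error[OF B measurable_position[OF that]])
    show "expectation (\<lambda>\<omega>. (noise.empirical_error B m (\<lambda>i. noise.position g m i \<omega>))\<^sup>2) \<le> 8 * cov_bound rate m"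
      if "binary_genealogy g m" for g
      by (rule noise.empirical_error_second_moment[OF that m B])
    show "\<bar>(noise.empirical_error B m (\<lambda>i. noise.position g m i \<omega>))\<^sup>2\<bar> \<le> 1" for g \<omega>
      using empirical_error_bound[of B m "\<lambda>i. noise.position g m i \<omega>"] by (simp add: abs_square_le_1)
    show "random_variable borel (\<lambda>\<omega>. (?D m \<omega>)\<^sup>2)" by (intro borel_measurable_power D_meas)
  qed
  have "AE \<omega> in M. (\<lambda>m. ?D (m + 2) \<omega>) \<longlonglongrightarrow> 0"
  proof (rule AE_tendsto_zero_if_summable_second_moments[where K = 1 and \<kappa> = "\<lambda>m. 8 * cov_bound rate (m + 2)"])
    show "summable (\<lambda>m. 8 * cov_bound rate (m + 2))"
      using summable_cov_bound[OF rate_pos] by (intro summable_mult) (subst summable_iff_shift)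
    show "expectation (\<lambda>\<omega>. (?D (m + 2) \<omega>)\<^sup>2) \<le> 8 * cov_bound rate (m + 2)" for m
      by (rule moment) simp
  qed (rule D_meas, rule empirical_error_bound)
  then show ?thesis
    by eventually_elim (rule LIMSEQ_offset)
qed

lemma strong_law_for_relative_system:
  assumes B: "B \<in> sets borel" and k: "\<And>m. m \<ge> 1 \<Longrightarrow> k m \<in> {1..2 ^ m}"
  shows "AE \<omega> in M. (\<lambda>m. (1 / 2 ^ m) * (\<Sum>i = 1..2 ^ m. indicator B (relative_system Z (real m) i \<omega>))
      - prob {\<omega>' \<in> space M. relative_system Z (real m) (k m) \<omega>' \<in> B}) \<longlonglongrightarrow> 0"
  using empirical_distribution_converges[OF B]
proof eventually_elim
  case (elim \<omega>)
  moreover have "\<forall>\<^sub>F m in sequentially. noise.empirical_error B m (\<lambda>i. relative_system Z (real m) i \<omega>)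
      = (1 / 2 ^ m) * (\<Sum>i = 1..2 ^ m. indicator B (relative_system Z (real m) i \<omega>))
        - prob {\<omega>' \<in> space M. relative_system Z (real m) (k m) \<omega>' \<in> B}"
    using eventually_ge_at_top[of 1]
    by eventually_elim (simp only: noise.empirical_error_def prob_relative_system[OF k B])
  ultimately show ?case by (rule Lim_transform_eventually)
qed

end

end

theorem theorem6p2:
  fixes M :: "'a measure" and b \<gamma> :: real
    and W :: "nat \<Rightarrow> nat \<Rightarrow> real \<Rightarrow> 'a \<Rightarrow> real"
    and par :: "nat \<Rightarrow> nat \<Rightarrow> 'a \<Rightarrow> nat"
    and Z :: "real \<Rightarrow> nat \<Rightarrow> 'a \<Rightarrow> real"
    and B :: "real set"
  assumes "interacting_branching_diffusion M b \<gamma> W par Z"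
    and "\<gamma> \<noteq> 0" and "\<gamma> + b > 0"
    and "B \<in> sets borel"
  shows "(\<forall>m\<ge>1. \<forall>i\<in>{1..2 ^ m}. \<forall>j\<in>{1..2 ^ m}.
            measure M {\<omega> \<in> space M. relative_system Z (real m) i \<omega> \<in> B} =
            measure M {\<omega> \<in> space M. relative_system Z (real m) j \<omega> \<in> B})
       \<and> (\<forall>k :: nat \<Rightarrow> nat. (\<forall>m\<ge>1. k m \<in> {1..2 ^ m}) \<longrightarrow>
            (AE \<omega> in M.
               (\<lambda>m. (1 / 2 ^ m) * (\<Sum>i = 1..2 ^ m. indicator B (relative_system Z (real m) i \<omega>))
                    - measure M {\<omega>' \<in> space M. relative_system Z (real m) (k m) \<omega>' \<in> B})
               \<longlonglongrightarrow> 0))"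
proof -
  interpret interacting_branching_diffusion M b \<gamma> W par Z by fact
  note B = \<open>B \<in> sets borel\<close> and rate = \<open>\<gamma> + b > 0\<close>
  show ?thesis
    using prob_relative_system[OF rate _ B] strong_law_for_relative_system[OF rate B] by simp
qed

end
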